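(* Let $n\ge 2$. Suppose $f$ is a positive continuous function on $S^{n-1}$ and $\nu$ is an isotropic $f$-centered Borel measure on $S^{n-1}$. Then \[V\left(W_{\nu,f}^* \right) \geq \frac{(n+1)^{(n+1)/2}}{n!}\, \|f\|_{L^2(\nu)}^{-n}\] with equality if and only if $\mathrm{conv}\,\mathrm{supp}\,\nu$ is a regular simplex inscribed in $S^{n-1}$ and $f$ is constant on $\mathrm{supp}\,\nu$.
   Context: The setting is Euclidean space $\mathbb{R}^n$, $n\ge 2$, with unit sphere $S^{n-1}$; $V$ denotes volume ($n$-dimensional Lebesgue measure). All Borel measures are non-negative and finite. $\mathrm{supp}\,\nu$ is the support of $\nu$ and $\mathrm{conv}$ denotes convex hull. $\|f\|_{L^2(\nu)}=\left(\int_{S^{n-1}} f^2\,d\nu\right)^{1/2}$. A Borel measure $\nu$ on $S^{n-1}$ is called isotropic if $\int_{S^{n-1}} u\otimes u\,d\nu(u)=I_n$, where $u\otimes u$ is the orthogonal projection onto the line spanned by $u$ and $I_n$ is the identity map on $\mathbb{R}^n$. For a positive continuous function $f$ on $S^{n-1}$, $\nu$ is called $f$-centered if $\int_{S^{n-1}} f(u)\,u\,d\nu(u)=o$, where $o$ is the origin. The Wulff shape determined by $\nu$ and $f$ is \[W_{\nu,f}=\{x\in\mathbb{R}^n: x\cdot u\le f(u)\text{ for all }u\in\mathrm{supp}\,\nu\}.\] When $\nu$ is isotropic and $f$-centered, $W_{\nu,f}$ is a compact convex set containing the origin in its interior. The polar body of a compact convex set $K$ containing the origin in its interior is $K^*=\{x\in\mathbb{R}^n: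 x\cdot y\le 1\text{ for all }y\in K\}$. *)

theory Defs
  imports "HOL-Analysis.Analysis"
begin

definition sphere_measure :: "('a::euclidean_space) measure \<Rightarrow> bool" where
  "sphere_measure \<nu> \<longleftrightarrow>
     finite_measure \<nu> \<and> sets \<nu> = sets (restrict_space borel (sphere 0 1))"

text \<open>
  The intersection with \<^term>\<open>space \<nu>\<close> matters: \<open>\<nu>\<close> lives on the sphere, so an open set of
  the ambient space is in general not \<open>\<nu>\<close>-measurable and would get measure \<open>0\<close>.
\<close>
definition msupport :: "('a::topological_space) measure \<Rightarrow> 'a set" where
  "msupport \<nu> = {u \<in> space \<nu>. \<forall>U. open U \<and> u \<in> U \<longrightarrow> emeasure \<nu> (U \<inter> space \<nu>) > 0}"

text \<open>Linear maps are represented by matrices, whose type (unlike that of bounded linear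
  functions) admits the Bochner integral.\<close>
definition tensor :: "real^'n \<Rightarrow> real^'n \<Rightarrow> real^'n^'n" (infixr \<open>\<otimes>\<^sub>t\<close> 75) where
  "u \<otimes>\<^sub>t v = (\<chi> i j. u $ i * v $ j)"

lemma tensor_mult_vec: "(u \<otimes>\<^sub>t v) *v x = (v \<bullet> x) *\<^sub>R u"
  by (simp add: tensor_def matrix_vector_mult_def inner_vec_def vec_eq_iff
        sum_distrib_left mult_ac)

definition isotropic :: "(real^'n) measure \<Rightarrow> bool" where
  "isotropic \<nu> \<longleftrightarrow> (\<integral>u. u \<otimes>\<^sub>t u \<partial>\<nu>) = mat 1"

definition f_centered :: "('a::euclidean_space \<Rightarrow> real) \<Rightarrow> 'a measure \<Rightarrow> bool" where
  "f_centered f \<nu> \<longleftrightarrow> (\<integral>u. f u *\<^sub>R u \<partial>\<nu>) = 0"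

definition wulff_shape :: "('a::euclidean_space) measure \<Rightarrow> ('a \<Rightarrow> real) \<Rightarrow> 'a set" where
  "wulff_shape \<nu> f = {x. \<forall>u\<in>msupport \<nu>. x \<bullet> u \<le> f u}"

definition polar_body :: "('a::real_inner) set \<Rightarrow> 'a set" where
  "polar_body K = {x. \<forall>y\<in>K. x \<bullet> y \<le> 1}"

definition L2_norm :: "'a measure \<Rightarrow> ('a \<Rightarrow> real) \<Rightarrow> real" where
  "L2_norm \<nu> f = sqrt (\<integral>u. (f u)\<^sup>2 \<partial>\<nu>)"

text \<open>The vertices of a simplex are its extreme points.\<close>
definition regular_simplex :: "('a::euclidean_space) set \<Rightarrow> bool" where
  "regular_simplex S \<longleftrightarrow> int DIM('a) simplex S \<and>
     (\<exists>d. \<forall>x y. x extreme_point_of S \<and> y extreme_point_of S \<and> x \<noteq> y \<longrightarrow> dist x y = d)"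

definition inscribed_in_unit_sphere :: "('a::euclidean_space) set \<Rightarrow> bool" where
  "inscribed_in_unit_sphere S \<longleftrightarrow> (\<forall>x. x extreme_point_of S \<longrightarrow> x \<in> sphere 0 1)"

end

theory Submission
  imports Defs "HOL-Probability.Probability"
begin

text \<open>
  The proof is a mass transport argument in one dimension more. Write \<open>n\<close> for the dimension, \<open>N = n + 1\<close>,
  \<open>r\<close> for the \<open>L\<^sup>2\<close> norm of \<open>f\<close>, and lift every direction \<open>u\<close> to the vector \<open>w(u) = (u, f(u) / r)\<close> of
  \<open>\<real>\<^sup>N\<close>. Isotropy of \<open>\<nu>\<close>, the centering condition and the choice of \<open>r\<close> say precisely that
  \<open>\<integral> w \<otimes> w d\<nu>\<close> is the identity of \<open>\<real>\<^sup>N\<close>. So the unit vectors \<open>\<omega> = w / |w|\<close> form an isotropic frame for the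
  measure \<open>d\<kappa> = |w|\<^sup>2 d\<nu>\<close>, whose total mass is \<open>N\<close>. On the other side, let \<open>C\<close> be the cone over the polar body \<open>K\<close>
  of the Wulff shape, with \<open>r t K\<close> as slice at height \<open>t > 0\<close>. If \<open>e\<close> denotes the vertical unit vector, slicing gives
  \<open>\<integral>\<^sub>C exp(- x \<bullet> e) dx = n! r\<^sup>n V(K)\<close>. The theorem becomes the statement that this integral is at least
  \<open>N\<close> to the power \<open>N / 2\<close>.
  
  Every positively weighted mean of the vectors \<open>\<omega>(u)\<close> lies in \<open>C\<close>. Hence so does
  \<open>\<Phi>(y) = \<integral> \<tau>(\<omega> \<bullet> y) / (\<omega> \<bullet> e) \<omega> d\<kappa>\<close>, where \<open>\<tau>\<close> is the increasing map that transports the standard Gaussian on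
  the line to the exponential distribution, that is, \<open>\<tau>'(s) exp(- \<tau>(s))\<close> is the Gaussian density. The map \<open>\<Phi>\<close> is
  injective, and \<open>\<Phi>(y) \<bullet> e = \<integral> \<tau>(\<omega> \<bullet> y) d\<kappa>\<close>. Its derivative is \<open>\<integral> t \<omega> \<otimes> \<omega> d\<kappa>\<close> with \<open>t = \<tau>'(\<omega> \<bullet> y) / (\<omega> \<bullet> e)\<close>,
  and the determinant of such a map is at least \<open>exp(\<integral> ln t d\<kappa>)\<close> (lemma \<open>det_frame_map_ge\<close>). In the product of
  \<open>exp(- \<Phi>(y) \<bullet> e)\<close> and the Jacobian the function \<open>\<tau>\<close> cancels. What remains is the Gaussian density of
  \<open>\<real>\<^sup>N\<close> times \<open>exp(- \<integral> ln (\<omega> \<bullet> e) d\<kappa>)\<close>, and this factor is at least \<open>N\<close> to the power \<open>N / 2\<close> because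
  \<open>\<integral> (\<omega> \<bullet> e)\<^sup>2 d\<kappa> = 1\<close> and the logarithm is concave. Integration over \<open>y\<close> gives the inequality (theorem
  \<open>cone_integral_ge\<close>).
  
  If equality holds, then \<open>\<omega> \<bullet> e\<close> is constant, and for suitable \<open>y\<close> each \<open>\<omega>(u)\<close> in the support is an eigenvector of the
  derivative of \<open>\<Phi>\<close> with eigenvalue \<open>t(u)\<close>. Since \<open>\<tau>'\<close> is not constant, \<open>y\<close> can be chosen such that two given distinct
  vectors of the support get different eigenvalues, so they are orthogonal (theorem
  \<open>cone_integral_eq_imp_orthogonal\<close>). An orthonormal frame with constant height is the lift of the vertices of a regular
  simplex on which \<open>f\<close> is constant. Conversely, over such a simplex the cone is contained in an orthant in whose coordinates
  \<open>exp(- x \<bullet> e)\<close> is a product, so the integral is at most \<open>N\<close> to the power \<open>N / 2\<close> (lemma \<open>integral_orthant_le\<close>).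
\<close>

section \<open>Symmetric maps have orthonormal eigenbases\<close>

text \<open>
  A maximum point \<open>v\<close> of the Rayleigh quotient on the unit sphere of \<open>S\<close> is an eigenvector. With \<open>l\<close> the maximum,
  \<open>B = l - A\<close> is positive semidefinite on \<open>S\<close> and its quadratic form vanishes at \<open>v\<close>. Then \<open>B v = 0\<close>, for otherwise a
  small step from \<open>v\<close> against \<open>B v\<close> would make the form negative.
\<close>

lemma symmetric_map_eigenvector:
  fixes A :: "'a::euclidean_space \<Rightarrow> 'a"
  assumes A: "linear A" and sym: "\<And>x y. A x \<bullet> y = x \<bullet> A y"
    and S: "subspace S" "A ` S \<subseteq> S" and nz: "x0 \<in> S" "x0 \<noteq> 0"
  obtains v l where "v \<in> S" "norm v = 1" "A v = l *\<^sub>R v"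
proof -
  have cont: "continuous_on UNIV A"
    using A linear_continuous_on linear_conv_bounded_linear by blast
  have "compact (S \<inter> sphere 0 1)"
    using S(1) by (simp add: closed_Int_compact closed_subspace)
  moreover have "x0 /\<^sub>R norm x0 \<in> S \<inter> sphere 0 1"
    using nz S(1) by (simp add: subspace_scale)
  moreover have "continuous_on (S \<inter> sphere 0 1) (\<lambda>x. A x \<bullet> x)"
    by (intro continuous_intros continuous_on_subset[OF cont]) auto
  ultimately have "\<exists>v\<in>S \<inter> sphere 0 1. \<forall>y\<in>S \<inter> sphere 0 1. A y \<bullet> y \<le> A v \<bullet> v"
    by (intro continuous_attains_sup) auto
  then obtain v where v: "v \<in> S" "norm v = 1"
      and vmax: "\<And>y. y \<in> S \<Longrightarrow> norm y = 1 \<Longrightarrow> A y \<bullet> y \<le> A v \<bullet> v"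
    by auto
  define l where "l = A v \<bullet> v"
  define B where "B x = l *\<^sub>R x - A x" for x
  have B: "linear B" unfolding B_def using A
    by (intro linear_compose_sub) (auto intro!: linearI simp: algebra_simps)
  have Bsym: "B x \<bullet> y = x \<bullet> B y" for x y
    using sym by (simp add: B_def algebra_simps)
  have Bpos: "0 \<le> B x \<bullet> x" if "x \<in> S" for x
  proof (cases "x = 0")
    case False
    have "A (x /\<^sub>R norm x) \<bullet> (x /\<^sub>R norm x) \<le> l"
      unfolding l_def using that S(1) False by (intro vmax) (auto simp: subspace_scale)
    then have "(A x \<bullet> x) / (norm x)\<^sup>2 \<le> l"
      by (simp add: linear_scale[OF A] power2_eq_square divide_inverse mult_ac)
    then have "A x \<bullet> x \<le> l * (norm x)\<^sup>2"
      using False by (simp add: field_simps)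
    then show ?thesis by (simp add: B_def algebra_simps power2_norm_eq_inner)
  qed (simp add: B_def linear_0[OF A])
  have Bv: "B v \<bullet> v = 0"
    using v by (simp add: B_def l_def algebra_simps norm_eq_1)
  have BvS: "B v \<in> S"
    using v S unfolding B_def by (auto intro!: subspace_diff subspace_scale)
  have "B v = 0"
  proof (rule ccontr)
    assume nz: "B v \<noteq> 0"
    define w where "w = B v"
    define b where "b = w \<bullet> w"
    define q where "q = B w \<bullet> w"
    have bpos: "b > 0" using nz by (simp add: b_def w_def)
    have q0: "q \<ge> 0" using Bpos BvS by (simp add: q_def w_def)
    have quad: "0 \<le> 2 * t * b + t\<^sup>2 * q" for t
    proof -
      have "v + t *\<^sub>R w \<in> S" using v BvS S(1) by (simp add: w_def subspace_add subspace_scale)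
      then have "0 \<le> B (v + t *\<^sub>R w) \<bullet> (v + t *\<^sub>R w)" by (rule Bpos)
      also have "\<dots> = B v \<bullet> v + t * (B v \<bullet> w) + t * (B w \<bullet> v) + t\<^sup>2 * (B w \<bullet> w)"
        by (simp add: linear_add[OF B] linear_scale[OF B] algebra_simps power2_eq_square)
      also have "\<dots> = 2 * t * b + t\<^sup>2 * q"
        using Bv Bsym[of w v] by (simp add: b_def q_def w_def)
      finally show ?thesis .
    qed
    \<comment> \<open>Small enough for the linear term \<open>2 t b\<close> to dominate; the \<open>+ 1\<close> covers the case \<open>q = 0\<close>.\<close>
    define t where "t = - (b / (q + 1))"
    have "t * (q + 1) = - b" using q0 by (simp add: t_def)
    moreover have "t < 0" using bpos q0 by (simp add: t_def)
    ultimately have "2 * t * b + t\<^sup>2 * q < 0"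
    proof -
      assume *: "t * (q + 1) = - b" and "t < 0"
      have "2 * t * b + t\<^sup>2 * q = t * (2 * b + t * q)" by (simp add: power2_eq_square algebra_simps)
      also have "t * q = - b - t" using * by (simp add: algebra_simps)
      also have "t * (2 * b + (- b - t)) = t * (b - t)" by simp
      also have "\<dots> < 0" using \<open>t < 0\<close> bpos by (simp add: mult_neg_pos)
      finally show ?thesis .
    qed
    with quad[of t] show False by simp
  qed
  then have "A v = l *\<^sub>R v" by (simp add: B_def)
  with v that show thesis by blast
qed

definition orthonormal_basis :: "'a::euclidean_space set \<Rightarrow> bool" where
  "orthonormal_basis B \<longleftrightarrow> pairwise orthogonal B \<and> (\<forall>b\<in>B. norm b = 1) \<and> span B = UNIV"

lemma symmetric_map_eigenbasis_subspace:
  fixes A :: "'a::euclidean_space \<Rightarrow> 'a"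
  assumes A: "linear A" and sym: "\<And>x y. A x \<bullet> y = x \<bullet> A y"
    and S: "subspace S" "A ` S \<subseteq> S"
  shows "\<exists>B. pairwise orthogonal B \<and> (\<forall>b\<in>B. norm b = 1) \<and> span B = S \<and> (\<forall>b\<in>B. \<exists>l. A b = l *\<^sub>R b)"
  using S
proof (induction "dim S" arbitrary: S rule: less_induct)
  case less
  show ?case
  proof (cases "S \<subseteq> {0}")
    case True
    then have "S = {0}" using less.prems(1) subspace_0 by blast
    then show ?thesis by (intro exI[of _ "{}"]) auto
  next
    case False
    then obtain x0 where "x0 \<in> S" "x0 \<noteq> 0" by blast
    with symmetric_map_eigenvector[OF A sym less.prems]
    obtain v l where v: "v \<in> S" "norm v = 1" and eig: "A v = l *\<^sub>R v" by metis
    define S' where "S' = {x \<in> S. x \<bullet> v = 0}"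
    have S'sub: "subspace S'"
      using less.prems(1) unfolding S'_def subspace_def by (auto simp: inner_left_distrib)
    have S'inv: "A ` S' \<subseteq> S'"
      using less.prems(2) eig by (auto simp: S'_def sym)
    have "v \<notin> S'" using v by (simp add: S'_def norm_eq_1)
    then have "S' \<subset> S" using v S'_def by blast
    then have "dim S' < dim S"
      using dim_psubset[of S' S] S'sub less.prems(1) by (metis span_eq_iff)
    from less.hyps[OF this S'sub S'inv] obtain B where B: "pairwise orthogonal B"
      "\<forall>b\<in>B. norm b = 1" "span B = S'" "\<forall>b\<in>B. \<exists>l. A b = l *\<^sub>R b" by blast
    have BS': "b \<in> S'" if "b \<in> B" for b using B(3) span_base[OF that] by simp
    have "pairwise orthogonal (insert v B)"
      using B(1) BS' by (auto simp: pairwise_insert orthogonal_def S'_def inner_commute)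
    moreover have "span (insert v B) = S"
    proof
      show "span (insert v B) \<subseteq> S"
        using v BS' less.prems(1) by (intro span_minimal) (auto simp: S'_def)
      show "S \<subseteq> span (insert v B)"
      proof
        fix x assume x: "x \<in> S"
        have "x - (x \<bullet> v) *\<^sub>R v \<in> S'"
          using x v less.prems(1) by (auto simp: S'_def subspace_diff subspace_scale inner_diff_left norm_eq_1)
        then have "x - (x \<bullet> v) *\<^sub>R v \<in> span B" using B(3) by simp
        then show "x \<in> span (insert v B)" by (auto simp: span_insert)
      qed
    qed
    ultimately show ?thesis using B v eig
      by (intro exI[of _ "insert v B"]) auto
  qed
qed

lemma symmetric_map_eigenbasis:
  fixes A :: "'a::euclidean_space \<Rightarrow> 'a"
  assumes "linear A" "\<And>x y. A x \<bullet> y = x \<bullet> A y"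
  obtains B l where "orthonormal_basis B" "\<And>b. b \<in> B \<Longrightarrow> A b = l b *\<^sub>R b"
  using symmetric_map_eigenbasis_subspace[OF assms subspace_UNIV]
  unfolding orthonormal_basis_def by (metis subset_UNIV)

lemma orthonormal_basis_facts:
  fixes B :: "'a::euclidean_space set"
  assumes "orthonormal_basis B"
  shows orthonormal_basis_finite: "finite B"
    and orthonormal_basis_card: "card B = DIM('a)"
    and orthonormal_basis_inner: "\<And>b b'. b \<in> B \<Longrightarrow> b' \<in> B \<Longrightarrow> b \<bullet> b' = (if b = b' then 1 else 0)"
proof -
  have B: "pairwise orthogonal B" "\<And>b. b \<in> B \<Longrightarrow> norm b = 1" "span B = UNIV"
    using assms by (auto simp: orthonormal_basis_def)
  have ind: "independent B"
    using B(1,2) pairwise_orthogonal_independent by fastforce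
  then show "finite B" by (rule independent_imp_finite)
  show "card B = DIM('a)" using ind B(3) by (metis dim_UNIV dim_span dim_eq_card_independent)
  show "b \<bullet> b' = (if b = b' then 1 else 0)" if "b \<in> B" "b' \<in> B" for b b'
    using B that by (auto simp: pairwise_def orthogonal_def norm_eq_1)
qed

lemma orthonormal_basis_expand:
  fixes B :: "'a::euclidean_space set"
  assumes "orthonormal_basis B"
  shows "(\<Sum>b\<in>B. (x \<bullet> b) *\<^sub>R b) = x"
proof -
  have "(x - (\<Sum>b\<in>B. (x \<bullet> b) *\<^sub>R b)) \<bullet> b' = 0" if "b' \<in> B" for b'
  proof -
    have "(\<Sum>b\<in>B. (x \<bullet> b) *\<^sub>R b) \<bullet> b' = (\<Sum>b\<in>B. (x \<bullet> b) * (if b = b' then 1 else 0))"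
      unfolding inner_sum_left inner_scaleR_left
      by (intro sum.cong refl arg_cong2[where f = "(*)"] orthonormal_basis_inner[OF assms] that)
    also have "\<dots> = x \<bullet> b'"
      using that orthonormal_basis_finite[OF assms] by (simp add: if_distrib cong: if_cong)
    finally show ?thesis by (simp add: inner_diff_left)
  qed
  then have "orthogonal (x - (\<Sum>b\<in>B. (x \<bullet> b) *\<^sub>R b)) y" for y
    using assms
    by (intro orthogonal_to_span[of y B]) (auto simp: orthonormal_basis_def orthogonal_def)
  from this[of "x - (\<Sum>b\<in>B. (x \<bullet> b) *\<^sub>R b)"] show ?thesis by (simp add: orthogonal_def)
qed

lemma orthonormal_basis_parseval:
  fixes B :: "'a::euclidean_space set"
  assumes "orthonormal_basis B"
  shows "x \<bullet> y = (\<Sum>b\<in>B. (x \<bullet> b) * (y \<bullet> b))"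
proof -
  have "x \<bullet> y = (\<Sum>b\<in>B. (x \<bullet> b) *\<^sub>R b) \<bullet> y"
    by (simp add: orthonormal_basis_expand[OF assms])
  then show ?thesis by (simp add: inner_sum_left inner_commute[of y])
qed

text \<open>
  The determinant is defined from matrix entries, so the matrix \<open>P\<close> whose rows are the basis vectors is used to
  compare the matrix of \<open>A\<close> with a diagonal one.
\<close>

lemma det_eigenbasis:
  fixes A :: "real^'m \<Rightarrow> real^'m"
  assumes A: "linear A" and B: "orthonormal_basis B"
    and eig: "\<And>b. b \<in> B \<Longrightarrow> A b = l b *\<^sub>R b"
  shows "det (matrix A) = (\<Prod>b\<in>B. l b)"
proof -
  have "card B = CARD('m)" using orthonormal_basis_card[OF B] by simp
  then obtain h where h: "bij_betw h (UNIV :: 'm set) B"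
    using finite_same_card_bij[OF finite_class.finite_UNIV orthonormal_basis_finite[OF B]] by metis
  have hB: "h i \<in> B" for i using h by (auto simp: bij_betw_def)
  define P :: "real^'m^'m" where "P = (\<chi> i. h i)"
  define D :: "real^'m^'m" where "D = (\<chi> i j. if i = j then l (h i) else 0)"
  have PP: "P ** transpose P = mat 1"
    using orthonormal_basis_inner[OF B hB hB] h
    by (auto simp: P_def matrix_matrix_mult_def transpose_def mat_def vec_eq_iff inner_vec_def
          bij_betw_def inj_on_def)
  have mA: "A x $ j = (\<Sum>k\<in>UNIV. matrix A $ j $ k * x $ k)" for x j
  proof -
    have "A x = matrix A *v x" by (simp add: A)
    then show ?thesis by (simp add: matrix_vector_mult_def)
  qed
  have "P ** transpose (matrix A) = D ** P"
  proof -
    have "(P ** transpose (matrix A)) $ i $ j = (D ** P) $ i $ j" for i j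
    proof -
      have "(P ** transpose (matrix A)) $ i $ j = A (h i) $ j"
        by (simp add: mA P_def matrix_matrix_mult_def transpose_def mult.commute)
      also have "\<dots> = (D ** P) $ i $ j"
        by (simp add: eig[OF hB] D_def P_def matrix_matrix_mult_def if_distrib[of "\<lambda>x. x * _"] cong: if_cong)
      finally show ?thesis .
    qed
    then show ?thesis by (simp add: vec_eq_iff)
  qed
  then have "det P * det (matrix A) = det D * det P"
    by (metis det_mul det_transpose)
  moreover have "det P \<noteq> 0"
    using PP by (metis det_I det_mul mult_eq_0_iff zero_neq_one)
  ultimately have "det (matrix A) = det D" by simp
  also have "det D = (\<Prod>i\<in>UNIV. D $ i $ i)"
    by (rule det_diagonal) (simp add: D_def)
  also have "\<dots> = (\<Prod>i\<in>UNIV. l (h i))" by (simp add: D_def)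
  also have "\<dots> = (\<Prod>b\<in>B. l b)" by (rule prod.reindex_bij_betw[OF h])
  finally show ?thesis .
qed

section \<open>Isotropic frames and the determinant inequality of Ball and Barthe\<close>

text \<open>
  The condition \<open>\<integral> \<omega> \<otimes> \<omega> d\<kappa> = I\<close> is stated through its bilinear form, which keeps all integrals real-valued.
\<close>

locale isotropic_frame = finite_measure \<kappa> for \<kappa> :: "'b measure" +
  fixes \<omega> :: "'b \<Rightarrow> real^'m"
  assumes omega_measurable [measurable]: "\<omega> \<in> borel_measurable \<kappa>"
    and norm_omega: "u \<in> space \<kappa> \<Longrightarrow> norm (\<omega> u) = 1"
    and isotropy: "(\<integral>u. (\<omega> u \<bullet> x) * (\<omega> u \<bullet> y) \<partial>\<kappa>) = x \<bullet> y"
begin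

lemma bounded_integrable:
  fixes g :: "'b \<Rightarrow> 'c::{banach, second_countable_topology}"
  assumes "g \<in> borel_measurable \<kappa>" "\<And>u. u \<in> space \<kappa> \<Longrightarrow> norm (g u) \<le> K"
  shows "integrable \<kappa> g"
  using assms by (intro integrable_const_bound[of g K]) auto

lemma abs_inner_omega_le: "u \<in> space \<kappa> \<Longrightarrow> \<bar>\<omega> u \<bullet> x\<bar> \<le> norm x"
  using Cauchy_Schwarz_ineq2[of "\<omega> u" x] norm_omega by simp

definition frame_map :: "('b \<Rightarrow> real) \<Rightarrow> real^'m \<Rightarrow> real^'m" where
  "frame_map t x = (\<integral>u. (t u * (\<omega> u \<bullet> x)) *\<^sub>R \<omega> u \<partial>\<kappa>)"

context
  fixes t :: "'b \<Rightarrow> real" and K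
  assumes t_measurable [measurable]: "t \<in> borel_measurable \<kappa>"
    and t_bound: "\<And>u. u \<in> space \<kappa> \<Longrightarrow> \<bar>t u\<bar> \<le> K"
begin

lemma weight_bound_nonneg: "u \<in> space \<kappa> \<Longrightarrow> 0 \<le> K"
  using t_bound by (meson abs_ge_zero order.trans)

lemma integrable_weight_inner:
  "integrable \<kappa> (\<lambda>u. t u * (\<omega> u \<bullet> x) * (\<omega> u \<bullet> y))"
  using abs_inner_omega_le t_bound
  by (intro bounded_integrable[of _ "K * norm x * norm y"])
     (auto simp: abs_mult weight_bound_nonneg intro!: mult_mono)

lemma integrable_frame_map: "integrable \<kappa> (\<lambda>u. (t u * (\<omega> u \<bullet> x)) *\<^sub>R \<omega> u)"
  using abs_inner_omega_le t_bound norm_omega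
  by (intro bounded_integrable[of _ "K * norm x"])
     (auto simp: abs_mult weight_bound_nonneg intro!: mult_mono)

lemma frame_map_inner: "frame_map t x \<bullet> y = (\<integral>u. t u * (\<omega> u \<bullet> x) * (\<omega> u \<bullet> y) \<partial>\<kappa>)"
  unfolding frame_map_def using integrable_frame_map[of x]
  by (subst integral_inner_left[symmetric]) auto

lemma frame_map_symmetric: "frame_map t x \<bullet> y = x \<bullet> frame_map t y"
  by (subst (2) inner_commute) (simp add: frame_map_inner mult_ac)

lemma linear_frame_map: "linear (frame_map t)"
proof (rule linearI)
  show "frame_map t (x + y) = frame_map t x + frame_map t y" for x y
    unfolding frame_map_def
    by (subst Bochner_Integration.integral_add[symmetric, OF integrable_frame_map integrable_frame_map])
       (simp add: algebra_simps)
  show "frame_map t (c *\<^sub>R x) = c *\<^sub>R frame_map t x" for c x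
    unfolding frame_map_def integral_scaleR_right[symmetric]
    by (simp add: mult_ac)
qed

end

text \<open>
  In an orthonormal eigenbasis \<open>B\<close> with eigenvalues \<open>l\<^sub>b\<close>, each \<open>l\<^sub>b\<close> is the mean of \<open>t\<close> with respect to the
  probability measure \<open>(\<omega> \<bullet> b)\<^sup>2 d\<kappa>\<close>. Jensen's inequality for the logarithm therefore bounds \<open>ln l\<^sub>b\<close> from below by
  the mean of \<open>ln t\<close>, and the densities \<open>(\<omega> \<bullet> b)\<^sup>2\<close> add up to 1. The function \<open>gap\<close> is the pointwise defect
  in \<open>ln x \<le> x - 1\<close> for \<open>x = t / l\<^sub>b\<close>. If it vanishes almost everywhere for all \<open>b\<close>, then \<open>t(u) = l\<^sub>b\<close>
  whenever \<open>\<omega>(u)\<close> has a component along \<open>b\<close>, that is, \<open>\<omega>(u)\<close> lies in the eigenspace of \<open>t(u)\<close>.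
\<close>

lemma det_frame_map_ge:
  assumes t [measurable]: "t \<in> borel_measurable \<kappa>"
    and m: "0 < m" "\<And>u. u \<in> space \<kappa> \<Longrightarrow> m \<le> t u"
    and K: "\<And>u. u \<in> space \<kappa> \<Longrightarrow> t u \<le> K"
  shows "exp (\<integral>u. ln (t u) \<partial>\<kappa>) \<le> det (matrix (frame_map t))" (is ?ineq)
    and "exp (\<integral>u. ln (t u) \<partial>\<kappa>) = det (matrix (frame_map t)) \<Longrightarrow>
           AE u in \<kappa>. frame_map t (\<omega> u) = t u *\<^sub>R \<omega> u" (is "?eq \<Longrightarrow> ?eigen")
proof -
  have tpos: "0 < t u" if "u \<in> space \<kappa>" for u using m that by (meson less_le_trans)
  have tabs: "\<bar>t u\<bar> \<le> K" if "u \<in> space \<kappa>" for u using tpos[OF that] K[OF that] by simp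
  note lin = linear_frame_map[OF t tabs]
  note inner = frame_map_inner[OF t tabs]
  obtain B l where B: "orthonormal_basis B" and eig: "\<And>b. b \<in> B \<Longrightarrow> frame_map t b = l b *\<^sub>R b"
    using symmetric_map_eigenbasis[OF lin frame_map_symmetric[OF t tabs]] by blast
  note fin = orthonormal_basis_finite[OF B]
  have bb: "b \<bullet> b = 1" if "b \<in> B" for b using orthonormal_basis_inner[OF B that that] by simp
  have int2: "integrable \<kappa> (\<lambda>u. (\<omega> u \<bullet> b)\<^sup>2)" for b
    using integrable_weight_inner[of "\<lambda>_. 1" 1 b b] by (simp add: power2_eq_square)
  have intt: "integrable \<kappa> (\<lambda>u. t u * (\<omega> u \<bullet> b)\<^sup>2)" for b
    using integrable_weight_inner[OF t tabs, of b b] by (simp add: power2_eq_square mult.assoc)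
  have lnb: "\<bar>ln (t u)\<bar> \<le> max \<bar>ln m\<bar> \<bar>ln K\<bar>" if "u \<in> space \<kappa>" for u
  proof -
    have "ln m \<le> ln (t u)" "ln (t u) \<le> ln K"
      using m(1) m(2)[OF that] K[OF that] tpos[OF that] by (auto intro: ln_mono)
    then show ?thesis by linarith
  qed
  have intln: "integrable \<kappa> (\<lambda>u. ln (t u) * (\<omega> u \<bullet> b)\<^sup>2)" for b
    using integrable_weight_inner[of "\<lambda>u. ln (t u)", OF _ lnb, of b b] by (simp add: power2_eq_square mult.assoc)
  have one: "(\<integral>u. (\<omega> u \<bullet> b)\<^sup>2 \<partial>\<kappa>) = 1" if "b \<in> B" for b
    using isotropy[of b b] bb[OF that] by (simp add: power2_eq_square)
  have leq: "(\<integral>u. t u * (\<omega> u \<bullet> b)\<^sup>2 \<partial>\<kappa>) = l b" if "b \<in> B" for b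
    using inner[of b b] eig[OF that] bb[OF that] by (simp add: power2_eq_square mult.assoc)
  have lpos: "0 < l b" if "b \<in> B" for b
  proof -
    have "m = (\<integral>u. m * (\<omega> u \<bullet> b)\<^sup>2 \<partial>\<kappa>)" using one[OF that] by simp
    also have "\<dots> \<le> (\<integral>u. t u * (\<omega> u \<bullet> b)\<^sup>2 \<partial>\<kappa>)"
      using m by (intro integral_mono intt integrable_mult_right int2) (auto intro: mult_right_mono)
    finally show ?thesis using leq[OF that] m by simp
  qed
  define gap where "gap b u = (t u / l b - 1 - ln (t u / l b)) * (\<omega> u \<bullet> b)\<^sup>2" for b u
  have gap_eq: "gap b u = (1 / l b) * (t u * (\<omega> u \<bullet> b)\<^sup>2) - (1 - ln (l b)) * (\<omega> u \<bullet> b)\<^sup>2 - ln (t u) * (\<omega> u \<bullet> b)\<^sup>2"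
    if "b \<in> B" "u \<in> space \<kappa>" for b u
    using lpos[OF that(1)] tpos[OF that(2)] by (simp add: gap_def ln_div algebra_simps)
  have gap_nonneg: "0 \<le> gap b u" if "b \<in> B" "u \<in> space \<kappa>" for b u
    using lpos[OF that(1)] tpos[OF that(2)] ln_le_minus_one[of "t u / l b"]
    by (simp add: gap_def)
  have gap_int: "integrable \<kappa> (gap b)" if "b \<in> B" for b
    by (subst Bochner_Integration.integrable_cong[OF refl gap_eq[OF that]])
       (auto intro!: Bochner_Integration.integrable_diff integrable_mult_right intt int2 intln)
  have gap_val: "(\<integral>u. gap b u \<partial>\<kappa>) = ln (l b) - (\<integral>u. ln (t u) * (\<omega> u \<bullet> b)\<^sup>2 \<partial>\<kappa>)" if "b \<in> B" for b
  proof -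
    have "(\<integral>u. gap b u \<partial>\<kappa>) = (\<integral>u. (1 / l b) * (t u * (\<omega> u \<bullet> b)\<^sup>2) - (1 - ln (l b)) * (\<omega> u \<bullet> b)\<^sup>2 - ln (t u) * (\<omega> u \<bullet> b)\<^sup>2 \<partial>\<kappa>)"
      by (intro Bochner_Integration.integral_cong refl gap_eq that)
    also have "\<dots> = (1 / l b) * l b - (1 - ln (l b)) * 1 - (\<integral>u. ln (t u) * (\<omega> u \<bullet> b)\<^sup>2 \<partial>\<kappa>)"
      using intt int2 intln leq[OF that] one[OF that]
      by (simp add: Bochner_Integration.integral_diff integrable_mult_right)
    finally show ?thesis using lpos[OF that] by simp
  qed
  have det: "det (matrix (frame_map t)) = (\<Prod>b\<in>B. l b)"
    by (rule det_eigenbasis[OF lin B eig])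
  have detpos: "det (matrix (frame_map t)) > 0"
    unfolding det using lpos by (intro prod_pos) auto
  have "(\<integral>u. ln (t u) \<partial>\<kappa>) = (\<integral>u. (\<Sum>b\<in>B. ln (t u) * (\<omega> u \<bullet> b)\<^sup>2) \<partial>\<kappa>)"
  proof (intro Bochner_Integration.integral_cong refl)
    fix u assume "u \<in> space \<kappa>"
    then have "(\<Sum>b\<in>B. (\<omega> u \<bullet> b)\<^sup>2) = 1"
      using orthonormal_basis_parseval[OF B, of "\<omega> u" "\<omega> u"] norm_omega[of u]
      by (simp add: power2_eq_square norm_eq_1)
    then show "ln (t u) = (\<Sum>b\<in>B. ln (t u) * (\<omega> u \<bullet> b)\<^sup>2)"
      by (simp add: sum_distrib_left[symmetric])
  qed
  also have "\<dots> = (\<Sum>b\<in>B. \<integral>u. ln (t u) * (\<omega> u \<bullet> b)\<^sup>2 \<partial>\<kappa>)"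
    using intln by (intro Bochner_Integration.integral_sum)
  finally have total: "ln (det (matrix (frame_map t))) - (\<integral>u. ln (t u) \<partial>\<kappa>) = (\<Sum>b\<in>B. \<integral>u. gap b u \<partial>\<kappa>)"
    using lpos by (simp add: det ln_prod[OF fin] less_imp_neq[THEN not_sym] gap_val sum_subtractf)
  have nn: "0 \<le> (\<integral>u. gap b u \<partial>\<kappa>)" if "b \<in> B" for b
    using gap_nonneg[OF that] by (intro Bochner_Integration.integral_nonneg) auto
  then have "0 \<le> (\<Sum>b\<in>B. \<integral>u. gap b u \<partial>\<kappa>)" by (rule sum_nonneg)
  then have "(\<integral>u. ln (t u) \<partial>\<kappa>) \<le> ln (det (matrix (frame_map t)))"
    using total by linarith
  then show ?ineq using detpos by (simp add: ln_ge_iff)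
  assume ?eq
  then have "(\<integral>u. ln (t u) \<partial>\<kappa>) = ln (det (matrix (frame_map t)))" by (metis ln_exp)
  with total have "(\<Sum>b\<in>B. \<integral>u. gap b u \<partial>\<kappa>) = 0" by simp
  then have "(\<integral>u. gap b u \<partial>\<kappa>) = 0" if "b \<in> B" for b
    using sum_nonneg_eq_0_iff[OF fin, of "\<lambda>b. \<integral>u. gap b u \<partial>\<kappa>"] nn that by auto
  then have "AE u in \<kappa>. gap b u = 0" if "b \<in> B" for b
    using integral_nonneg_eq_0_iff_AE[OF gap_int[OF that]] gap_nonneg[OF that] that by auto
  then have "AE u in \<kappa>. \<forall>b\<in>B. gap b u = 0"
    using fin by (intro AE_finite_allI) auto
  then show ?eigen using AE_space
  proof eventually_elim
    case (elim u)
    have "(\<omega> u \<bullet> b) * l b = t u * (\<omega> u \<bullet> b)" if "b \<in> B" for b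
    proof (cases "\<omega> u \<bullet> b = 0")
      case False
      have "0 < t u / l b" using lpos[OF that] tpos[OF elim(2)] by simp
      moreover have "ln (t u / l b) = t u / l b - 1"
        using elim(1) that False by (auto simp: gap_def)
      ultimately have "t u / l b = 1" by (rule ln_eq_minus_one)
      then show ?thesis using lpos[OF that] by (simp add: field_simps)
    qed simp
    then have "(\<Sum>b\<in>B. ((\<omega> u \<bullet> b) * l b) *\<^sub>R b) = (\<Sum>b\<in>B. (t u * (\<omega> u \<bullet> b)) *\<^sub>R b)"
      by (intro sum.cong refl) simp
    also have "\<dots> = t u *\<^sub>R (\<Sum>b\<in>B. (\<omega> u \<bullet> b) *\<^sub>R b)"
      by (simp add: scaleR_sum_right)
    finally have "(\<Sum>b\<in>B. ((\<omega> u \<bullet> b) * l b) *\<^sub>R b) = t u *\<^sub>R \<omega> u"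
      by (simp add: orthonormal_basis_expand[OF B])
    moreover have "frame_map t (\<omega> u) = frame_map t (\<Sum>b\<in>B. (\<omega> u \<bullet> b) *\<^sub>R b)"
      by (simp add: orthonormal_basis_expand[OF B])
    then have "frame_map t (\<omega> u) = (\<Sum>b\<in>B. (\<omega> u \<bullet> b) *\<^sub>R frame_map t b)"
      by (simp add: linear_sum[OF lin] linear_scale[OF lin])
    ultimately show ?case by (simp add: eig)
  qed
qed

end

section \<open>Transporting the Gaussian to the exponential distribution\<close>

lemma std_normal_cdf_deriv:
  "(cdf std_normal_distribution has_real_derivative std_normal_density s) (at s)"
proof -
  let ?M = "std_normal_distribution" and ?\<phi> = "std_normal_density"
  interpret real_distribution ?M by (rule real_dist_normal_dist)
  have cont: "continuous_on S ?\<phi>" for S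
    by (auto simp: normal_density_def intro!: continuous_intros)
  have diff: "cdf ?M x = cdf ?M (s - 1) + integral {s - 1..x} ?\<phi>" if x: "s - 1 \<le> x" for x
  proof -
    have "(?\<phi> has_integral integral {s - 1..x} ?\<phi>) {s - 1..x}"
      by (intro integrable_integral integrable_continuous_real cont)
    then have "(\<integral>\<^sup>+t. ennreal (indicator {s - 1..x} t * ?\<phi> t) \<partial>lborel) = ennreal (integral {s - 1..x} ?\<phi>)"
      by (intro nn_integral_has_integral_lebesgue) auto
    moreover have "emeasure ?M {s - 1<..x} = (\<integral>\<^sup>+t. ennreal (indicator {s - 1..x} t * ?\<phi> t) \<partial>lborel)"
      using AE_lborel_singleton[of "s - 1"]
      by (subst emeasure_density) (auto intro!: nn_integral_cong_AE elim!: eventually_mono split: split_indicator)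
    ultimately have "measure ?M {s - 1<..x} = integral {s - 1..x} ?\<phi>"
      by (simp add: measure_def integral_nonneg integrable_continuous_real cont)
    moreover have "cdf ?M x - cdf ?M (s - 1) = measure ?M {s - 1<..x}"
    proof (cases "s - 1 = x")
      case False
      with x show ?thesis by (intro cdf_diff_eq) auto
    qed auto
    ultimately show ?thesis by simp
  qed
  have "((\<lambda>x. cdf ?M (s - 1) + integral {s - 1..x} ?\<phi>) has_real_derivative 0 + ?\<phi> s) (at s within {s - 1..s + 1})"
    by (intro DERIV_add DERIV_const integral_has_real_derivative cont) auto
  then have "((\<lambda>x. cdf ?M (s - 1) + integral {s - 1..x} ?\<phi>) has_real_derivative ?\<phi> s) (at s)"
    by (simp add: at_within_Icc_at)
  then show ?thesis
    by (rule has_field_derivative_transform_within_open[where S = "{s - 1<..}"]) (simp_all add: diff[symmetric])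
qed

text \<open>
  The tail of the exponential distribution at \<open>x\<close> is \<open>exp(- x)\<close>, so matching tails gives \<open>\<tau> = - ln (1 - F)\<close>, where \<open>F\<close> is
  the Gaussian distribution function. The derivative \<open>\<tau>'\<close> is the hazard rate of the Gaussian; that it takes two different
  values is what the equality case needs.
\<close>

lemma gaussian_to_exponential_transport:
  obtains \<tau> \<tau>' :: "real \<Rightarrow> real" and s1 s2 where
    "\<And>s. (\<tau> has_real_derivative \<tau>' s) (at s)" "continuous_on UNIV \<tau>'"
    "\<And>s. 0 < \<tau> s" "\<And>s. 0 < \<tau>' s"
    "\<And>s. ln (\<tau>' s) - \<tau> s = - (s\<^sup>2 / 2) - ln (2 * pi) / 2"
    "\<tau>' s1 \<noteq> \<tau>' s2"
proof -
  let ?M = "std_normal_distribution" and ?\<phi> = "std_normal_density"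
  interpret real_distribution ?M by (rule real_dist_normal_dist)
  define F where "F = cdf ?M"
  have F': "(F has_real_derivative ?\<phi> s) (at s)" for s
    unfolding F_def by (rule std_normal_cdf_deriv)
  have \<phi>pos: "?\<phi> s > 0" for s by (simp add: normal_density_pos)
  have mono: "F a < F b" if "a < b" for a b
    using DERIV_pos_imp_increasing[OF that] F' \<phi>pos by blast
  have F1: "F s < 1" for s
    using mono[of s "s + 1"] cdf_bounded_prob[of "s + 1"] by (simp add: F_def)
  have F0: "0 < F s" for s
    using mono[of "s - 1" s] cdf_nonneg[of "s - 1"] by (simp add: F_def)
  have Fcont: "continuous_on UNIV F"
    using F' by (meson DERIV_isCont continuous_at_imp_continuous_on)
  define \<tau> where "\<tau> s = - ln (1 - F s)" for s
  define \<tau>' where "\<tau>' s = ?\<phi> s / (1 - F s)" for s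
  have d: "(\<tau> has_real_derivative \<tau>' s) (at s)" for s
    unfolding \<tau>_def \<tau>'_def using F1[of s]
    by (auto intro!: derivative_eq_intros F' simp: field_simps)
  have c: "continuous_on UNIV \<tau>'"
    unfolding \<tau>'_def normal_density_def using F1
    by (auto intro!: continuous_intros Fcont simp: less_imp_neq[THEN not_sym] less_imp_neq)
  have p: "0 < \<tau> s" for s
    unfolding \<tau>_def using F0[of s] F1[of s] by simp
  have p': "0 < \<tau>' s" for s
    unfolding \<tau>'_def using F1[of s] \<phi>pos[of s] by simp
  have l: "ln (\<tau>' s) - \<tau> s = - (s\<^sup>2 / 2) - ln (2 * pi) / 2" for s
  proof -
    have "ln (\<tau>' s) - \<tau> s = ln (?\<phi> s)"
      using F1[of s] \<phi>pos[of s] by (simp add: \<tau>_def \<tau>'_def ln_div)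
    also have "\<dots> = - (s\<^sup>2 / 2) - ln (2 * pi) / 2"
      by (simp add: normal_density_def ln_mult ln_div ln_sqrt)
    finally show ?thesis .
  qed
  obtain s1 s2 where "\<tau>' s1 \<noteq> \<tau>' s2"
  proof (rule ccontr)
    assume "\<not> thesis"
    then have eq: "\<tau>' s = \<tau>' 0" for s using that by blast
    have \<phi>: "?\<phi> = (\<lambda>s. \<tau>' 0 * (1 - F s))"
    proof
      fix s
      show "?\<phi> s = \<tau>' 0 * (1 - F s)"
        using eq[of s, symmetric] F1[of s] by (simp add: \<tau>'_def)
    qed
    have slope: "s = \<tau>' 0" for s
    proof -
      \<comment> \<open>A constant hazard rate would mean that \<open>\<phi>\<close> is a multiple of \<open>1 - F\<close>. Then \<open>\<phi>'\<close> would be a constant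
        multiple of \<open>\<phi>\<close>, whereas in fact \<open>\<phi>'(s) = - s \<phi>(s)\<close>.\<close>
      have "(?\<phi> has_real_derivative - s * ?\<phi> s) (at s)"
      proof -
        define k where "k = 1 / sqrt (2 * pi)"
        have "std_normal_density = (\<lambda>s. k * exp (- (s\<^sup>2 / 2)))"
          by (simp add: normal_density_def[abs_def] k_def)
        then show ?thesis by (auto intro!: derivative_eq_intros)
      qed
      moreover have "((\<lambda>s. \<tau>' 0 * (1 - F s)) has_real_derivative \<tau>' 0 * (0 - ?\<phi> s)) (at s)"
        by (rule DERIV_cmult[OF DERIV_diff[OF DERIV_const F']])
      then have "(?\<phi> has_real_derivative \<tau>' 0 * (0 - ?\<phi> s)) (at s)"
        by (rule ssubst[OF \<phi>, of "\<lambda>g. (g has_real_derivative \<tau>' 0 * (0 - ?\<phi> s)) (at s)"])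
      ultimately have "- s * ?\<phi> s = \<tau>' 0 * (0 - ?\<phi> s)" by (rule DERIV_unique)
      then show ?thesis using \<phi>pos[of s] by simp
    qed
    from slope[of 0] slope[of 1] show False by simp
  qed
  with that[OF d c p p' l] show thesis .
qed

section \<open>The transport map\<close>

text \<open>
  The error of the linear approximation is uniform in \<open>s\<close>, which allows differentiation under the integral sign: the
  arguments \<open>\<omega>(u) \<bullet> y\<close> of \<open>\<tau>\<close> range over a bounded interval, because the vectors \<open>\<omega>(u)\<close> are unit vectors.
\<close>

lemma uniform_linearization:
  fixes \<tau> \<tau>' :: "real \<Rightarrow> real"
  assumes d: "\<And>s. (\<tau> has_real_derivative \<tau>' s) (at s)" and c: "continuous_on UNIV \<tau>'"
    and \<epsilon>: "0 < \<epsilon>"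
  obtains d where "0 < d"
    "\<And>s h. \<bar>s\<bar> \<le> R \<Longrightarrow> \<bar>h\<bar> < d \<Longrightarrow> \<bar>\<tau> (s + h) - \<tau> s - \<tau>' s * h\<bar> \<le> \<epsilon> * \<bar>h\<bar>"
proof -
  have "uniformly_continuous_on {- (\<bar>R\<bar> + 1)..\<bar>R\<bar> + 1} \<tau>'"
    by (intro compact_uniformly_continuous continuous_on_subset[OF c]) auto
  then obtain d0 where d0: "d0 > 0" and
    near: "\<And>s s'. s \<in> {- (\<bar>R\<bar> + 1)..\<bar>R\<bar> + 1} \<Longrightarrow> s' \<in> {- (\<bar>R\<bar> + 1)..\<bar>R\<bar> + 1} \<Longrightarrow>
       \<bar>s' - s\<bar> < d0 \<Longrightarrow> \<bar>\<tau>' s' - \<tau>' s\<bar> < \<epsilon>"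
    using \<epsilon> unfolding uniformly_continuous_on_def dist_real_def by metis
  show thesis
  proof (rule that[of "min d0 1"])
    fix s h :: real assume s: "\<bar>s\<bar> \<le> R" and h: "\<bar>h\<bar> < min d0 1"
    have "\<exists>\<xi>. \<bar>\<xi> - s\<bar> \<le> \<bar>h\<bar> \<and> \<tau> (s + h) - \<tau> s = \<tau>' \<xi> * h"
    proof (cases h "0::real" rule: linorder_cases)
      case less
      then obtain z where "s + h < z" "z < s" "\<tau> s - \<tau> (s + h) = (s - (s + h)) * \<tau>' z"
        using MVT2[of "s + h" s \<tau> \<tau>'] d by auto
      then show ?thesis using less by (intro exI[of _ z]) (auto simp: algebra_simps)
    next
      case greater
      then obtain z where "s < z" "z < s + h" "\<tau> (s + h) - \<tau> s = (s + h - s) * \<tau>' z"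
        using MVT2[of s "s + h" \<tau> \<tau>'] d by auto
      then show ?thesis using greater by (intro exI[of _ z]) (auto simp: algebra_simps)
    qed auto
    then obtain \<xi> where \<xi>: "\<bar>\<xi> - s\<bar> \<le> \<bar>h\<bar>" "\<tau> (s + h) - \<tau> s = \<tau>' \<xi> * h" by blast
    have "\<bar>\<tau>' \<xi> - \<tau>' s\<bar> < \<epsilon>"
      using s h \<xi>(1) by (intro near) auto
    moreover have "\<tau> (s + h) - \<tau> s - \<tau>' s * h = (\<tau>' \<xi> - \<tau>' s) * h"
      using \<xi>(2) by (simp add: algebra_simps)
    ultimately show "\<bar>\<tau> (s + h) - \<tau> s - \<tau>' s * h\<bar> \<le> \<epsilon> * \<bar>h\<bar>"
      by (simp add: abs_mult mult_right_mono)
  qed (use d0 in auto)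
qed

text \<open>
  The bounds on an interval will be used at the arguments \<open>\<omega>(u) \<bullet> y\<close>, whose absolute value is at most \<open>|y|\<close>.
\<close>

lemma continuous_bounded_on_interval:
  fixes g :: "real \<Rightarrow> real"
  assumes "continuous_on UNIV g"
  obtains K where "\<And>s. \<bar>s\<bar> \<le> R \<Longrightarrow> \<bar>g s\<bar> \<le> K"
proof -
  have "compact (g ` {- R..R})"
    by (intro compact_continuous_image continuous_on_subset[OF assms]) auto
  then obtain K where "\<forall>x \<in> g ` {- R..R}. norm x \<le> K"
    using compact_imp_bounded bounded_iff by metis
  then have "\<bar>g s\<bar> \<le> K" if "s \<in> {- R..R}" for s using that by auto
  then show thesis by (intro that[of K]) (simp add: abs_le_iff)
qed

lemma continuous_positive_bounded_below_on_interval: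
  fixes g :: "real \<Rightarrow> real"
  assumes "continuous_on UNIV g" "\<And>s. 0 < g s"
  obtains m where "0 < m" "\<And>s. \<bar>s\<bar> \<le> R \<Longrightarrow> m \<le> g s"
proof -
  have "continuous_on UNIV (\<lambda>s. inverse (g s))"
    using assms by (auto intro!: continuous_intros simp: less_imp_neq[THEN not_sym])
  from continuous_bounded_on_interval[OF this, where R = R] obtain K
    where K: "\<And>s. \<bar>s\<bar> \<le> R \<Longrightarrow> \<bar>inverse (g s)\<bar> \<le> K" by blast
  have "inverse (max K 1) \<le> g s" if "\<bar>s\<bar> \<le> R" for s
  proof -
    have "inverse (g s) \<le> max K 1" using K[OF that] by linarith
    then have "inverse (max K 1) \<le> inverse (inverse (g s))"
      using assms(2)[of s] by (intro le_imp_inverse_le) auto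
    then show ?thesis by simp
  qed
  then show thesis by (intro that[of "inverse (max K 1)"]) auto
qed

text \<open>
  The function \<open>\<tau>\<close> is a parameter with the properties that lemma \<open>gaussian_to_exponential_transport\<close> provides; the
  logarithmic form of the equation \<open>\<tau>'(s) exp(- \<tau>(s)) = \<phi>(s)\<close> is the one that integrates against \<open>\<kappa>\<close>. Heights above a
  positive \<open>\<delta>\<close> keep the division by \<open>\<omega> \<bullet> e\<close> bounded.
\<close>

locale cone_transport = isotropic_frame \<kappa> \<omega>
  for \<kappa> :: "'b measure" and \<omega> :: "'b \<Rightarrow> real^'m::{finite, wellorder}" +
  fixes e :: "real^'m::{finite, wellorder}" and \<delta> :: real and \<tau> \<tau>' :: "real \<Rightarrow> real"
  assumes delta_pos: "0 < \<delta>" and inner_e: "u \<in> space \<kappa> \<Longrightarrow> \<delta> \<le> \<omega> u \<bullet> e"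
    and norm_e: "norm e = 1"
    and tau_deriv: "(\<tau> has_real_derivative \<tau>' s) (at s)"
    and tau'_cont: "continuous_on UNIV \<tau>'"
    and tau'_pos: "0 < \<tau>' s"
    and tau_ode: "ln (\<tau>' s) - \<tau> s = - (s\<^sup>2 / 2) - ln (2 * pi) / 2"
begin

text \<open>
  The factor \<open>1 / (\<omega> \<bullet> e)\<close> is chosen such that the height of the image is \<open>\<integral> \<tau>(\<omega> \<bullet> y) d\<kappa>\<close>.
\<close>

definition transport :: "real^'m::_ \<Rightarrow> real^'m::_" where
  "transport y = (\<integral>u. (\<tau> (\<omega> u \<bullet> y) / (\<omega> u \<bullet> e)) *\<^sub>R \<omega> u \<partial>\<kappa>)"

definition weight :: "real^'m::_ \<Rightarrow> 'b \<Rightarrow> real" where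
  "weight y u = \<tau>' (\<omega> u \<bullet> y) / (\<omega> u \<bullet> e)"

lemma tau_cont: "continuous_on S \<tau>"
  using tau_deriv by (meson DERIV_isCont continuous_at_imp_continuous_on)

lemma tau_measurable [measurable]: "\<tau> \<in> borel_measurable borel" "\<tau>' \<in> borel_measurable borel"
  using tau_cont tau'_cont by (auto intro: borel_measurable_continuous_onI)

lemma weight_measurable [measurable]: "weight y \<in> borel_measurable \<kappa>"
  unfolding weight_def[abs_def] by measurable

lemma inner_e_pos: "u \<in> space \<kappa> \<Longrightarrow> 0 < \<omega> u \<bullet> e"
  using inner_e delta_pos by (meson less_le_trans)

lemma divide_inner_e_le:
  assumes "u \<in> space \<kappa>" "\<bar>a\<bar> \<le> K"
  shows "\<bar>a / (\<omega> u \<bullet> e)\<bar> \<le> K / \<delta>"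
  using inner_e[OF assms(1)] delta_pos assms(2) by (simp add: abs_divide frac_le)

lemma inner_e_le_1: "u \<in> space \<kappa> \<Longrightarrow> \<omega> u \<bullet> e \<le> 1"
  using abs_inner_omega_le[of u e] norm_e by simp

lemma weight_bounds:
  obtains m K where "0 < m" "\<And>u. u \<in> space \<kappa> \<Longrightarrow> m \<le> weight y u" "\<And>u. u \<in> space \<kappa> \<Longrightarrow> weight y u \<le> K"
proof -
  obtain K where K: "\<And>s. \<bar>s\<bar> \<le> norm y \<Longrightarrow> \<bar>\<tau>' s\<bar> \<le> K"
    using continuous_bounded_on_interval[OF tau'_cont] by blast
  obtain m where m: "0 < m" "\<And>s. \<bar>s\<bar> \<le> norm y \<Longrightarrow> m \<le> \<tau>' s"
    using continuous_positive_bounded_below_on_interval[OF tau'_cont tau'_pos] by blast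
  show thesis
  proof (rule that[of m "K / \<delta>"])
    fix u assume u: "u \<in> space \<kappa>"
    note b = abs_inner_omega_le[OF u, of y]
    have "m * (\<omega> u \<bullet> e) \<le> m * 1" using m(1) inner_e_le_1[OF u] by (intro mult_left_mono) auto
    then have "m \<le> m / (\<omega> u \<bullet> e)" using inner_e_pos[OF u] by (simp add: field_simps)
    also have "\<dots> \<le> weight y u"
      unfolding weight_def using m(2)[OF b] inner_e_pos[OF u] by (simp add: divide_right_mono)
    finally show "m \<le> weight y u" .
    show "weight y u \<le> K / \<delta>"
      using divide_inner_e_le[OF u K[OF b]] unfolding weight_def by linarith
  qed (rule m)
qed

lemma integrable_transport: "integrable \<kappa> (\<lambda>u. (\<tau> (\<omega> u \<bullet> y) / (\<omega> u \<bullet> e)) *\<^sub>R \<omega> u)"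
proof -
  obtain K where K: "\<And>s. \<bar>s\<bar> \<le> norm y \<Longrightarrow> \<bar>\<tau> s\<bar> \<le> K"
    using continuous_bounded_on_interval[OF tau_cont] by blast
  show ?thesis
    using divide_inner_e_le[OF _ K[OF abs_inner_omega_le]] norm_omega
    by (intro bounded_integrable[of _ "K / \<delta>"]) auto
qed

lemma integrable_frame_map_weight: "integrable \<kappa> (\<lambda>u. (weight y u * (\<omega> u \<bullet> x)) *\<^sub>R \<omega> u)"
proof -
  obtain m K where "0 < m" "\<And>u. u \<in> space \<kappa> \<Longrightarrow> m \<le> weight y u" "\<And>u. u \<in> space \<kappa> \<Longrightarrow> weight y u \<le> K"
    using weight_bounds[of y] by blast
  then have "\<bar>weight y u\<bar> \<le> K" if "u \<in> space \<kappa>" for u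
    using that by (smt (verit))
  then show ?thesis by (rule integrable_frame_map[OF weight_measurable])
qed

lemma linear_frame_map_weight: "linear (frame_map (weight y))"
  and frame_map_weight_symmetric: "frame_map (weight y) a \<bullet> b = a \<bullet> frame_map (weight y) b"
proof -
  obtain m K where "0 < m" "\<And>u. u \<in> space \<kappa> \<Longrightarrow> m \<le> weight y u" "\<And>u. u \<in> space \<kappa> \<Longrightarrow> weight y u \<le> K"
    using weight_bounds[of y] by blast
  then have *: "\<bar>weight y u\<bar> \<le> K" if "u \<in> space \<kappa>" for u
    using that by (smt (verit))
  show "linear (frame_map (weight y))" by (rule linear_frame_map[OF weight_measurable *])
  show "frame_map (weight y) a \<bullet> b = a \<bullet> frame_map (weight y) b"
    by (rule frame_map_symmetric[OF weight_measurable *])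
qed

lemma transport_deriv: "(transport has_derivative frame_map (weight y)) (at y)"
  unfolding has_derivative_at_alt
proof (intro conjI allI impI)
  show "bounded_linear (frame_map (weight y))"
    using linear_frame_map_weight linear_conv_bounded_linear by blast
  fix \<epsilon> :: real assume \<epsilon>: "0 < \<epsilon>"
  define \<mu> where "\<mu> = measure \<kappa> (space \<kappa>)"
  define \<eta> where "\<eta> = \<epsilon> * \<delta> / (\<mu> + 1)"
  have \<mu>: "0 \<le> \<mu>" by (simp add: \<mu>_def)
  have "0 < \<eta>" using \<epsilon> delta_pos \<mu> by (simp add: \<eta>_def)
  from uniform_linearization[OF tau_deriv tau'_cont this, where R = "norm y"]
  obtain d where d: "0 < d" and lin: "\<And>s h. \<bar>s\<bar> \<le> norm y \<Longrightarrow> \<bar>h\<bar> < d \<Longrightarrow>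
      \<bar>\<tau> (s + h) - \<tau> s - \<tau>' s * h\<bar> \<le> \<eta> * \<bar>h\<bar>" by blast
  show "\<exists>d>0. \<forall>z. norm (z - y) < d \<longrightarrow>
      norm (transport z - transport y - frame_map (weight y) (z - y)) \<le> \<epsilon> * norm (z - y)"
  proof (intro exI[of _ d] conjI allI impI d)
    fix z assume z: "norm (z - y) < d"
    define r where "r u = (\<tau> (\<omega> u \<bullet> z) - \<tau> (\<omega> u \<bullet> y) - \<tau>' (\<omega> u \<bullet> y) * (\<omega> u \<bullet> (z - y))) / (\<omega> u \<bullet> e)" for u
    have "transport z - transport y - frame_map (weight y) (z - y) = (\<integral>u. r u *\<^sub>R \<omega> u \<partial>\<kappa>)"
      unfolding transport_def frame_map_def
        Bochner_Integration.integral_diff[symmetric, OF integrable_transport integrable_transport]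
        Bochner_Integration.integral_diff[symmetric, OF Bochner_Integration.integrable_diff[OF integrable_transport integrable_transport]
            integrable_frame_map_weight]
      by (intro Bochner_Integration.integral_cong refl)
         (simp add: r_def weight_def diff_divide_distrib scaleR_left_diff_distrib)
    also have "norm \<dots> \<le> (\<integral>u. norm (r u *\<^sub>R \<omega> u) \<partial>\<kappa>)"
      by (rule integral_norm_bound)
    also have "\<dots> \<le> (\<integral>u. \<eta> * norm (z - y) / \<delta> \<partial>\<kappa>)"
    proof (rule integral_mono')
      fix u assume u: "u \<in> space \<kappa>"
      have h: "\<bar>\<omega> u \<bullet> (z - y)\<bar> \<le> norm (z - y)" by (rule abs_inner_omega_le[OF u])
      have "\<bar>\<tau> (\<omega> u \<bullet> y + \<omega> u \<bullet> (z - y)) - \<tau> (\<omega> u \<bullet> y) - \<tau>' (\<omega> u \<bullet> y) * (\<omega> u \<bullet> (z - y))\<bar>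
             \<le> \<eta> * \<bar>\<omega> u \<bullet> (z - y)\<bar>"
        using h z by (intro lin abs_inner_omega_le[OF u]) auto
      also have "\<dots> \<le> \<eta> * norm (z - y)"
        using h \<open>0 < \<eta>\<close> by (intro mult_left_mono) auto
      finally have "\<bar>r u\<bar> \<le> \<eta> * norm (z - y) / \<delta>"
        unfolding r_def by (intro divide_inner_e_le[OF u]) (simp add: inner_diff_right)
      then show "norm (r u *\<^sub>R \<omega> u) \<le> \<eta> * norm (z - y) / \<delta>"
        using norm_omega[OF u] by simp
    qed (use \<open>0 < \<eta>\<close> delta_pos in auto)
    also have "\<dots> = \<epsilon> * norm (z - y) * (\<mu> / (\<mu> + 1))"
      using delta_pos by (simp add: \<eta>_def \<mu>_def)
    also have "\<dots> \<le> \<epsilon> * norm (z - y) * 1"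
      using \<mu> \<epsilon> by (intro mult_left_mono) auto
    finally show "norm (transport z - transport y - frame_map (weight y) (z - y)) \<le> \<epsilon> * norm (z - y)"
      by simp
  qed
qed

lemma tau_strict_mono: "strict_mono \<tau>"
  using DERIV_pos_imp_increasing tau_deriv tau'_pos by (metis strict_monoI)

text \<open>
  The map, written \<open>\<Phi>\<close>, is strictly monotone: \<open>(\<Phi>(y) - \<Phi>(z)) \<bullet> (y - z)\<close> is an integral of nonnegative terms, and it vanishes
  only if \<open>\<omega> \<bullet> (y - z) = 0\<close> almost everywhere, which isotropy excludes for \<open>y \<noteq> z\<close>.
\<close>

lemma transport_inj: "inj transport"
proof (rule injI)
  fix y z assume eq: "transport y = transport z"
  define g where "g u = (\<tau> (\<omega> u \<bullet> y) - \<tau> (\<omega> u \<bullet> z)) / (\<omega> u \<bullet> e) * (\<omega> u \<bullet> (y - z))" for u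
  have int: "integrable \<kappa> (\<lambda>u. ((\<tau> (\<omega> u \<bullet> y) / (\<omega> u \<bullet> e)) *\<^sub>R \<omega> u - (\<tau> (\<omega> u \<bullet> z) / (\<omega> u \<bullet> e)) *\<^sub>R \<omega> u))"
    by (intro Bochner_Integration.integrable_diff integrable_transport)
  have g: "g = (\<lambda>u. ((\<tau> (\<omega> u \<bullet> y) / (\<omega> u \<bullet> e)) *\<^sub>R \<omega> u - (\<tau> (\<omega> u \<bullet> z) / (\<omega> u \<bullet> e)) *\<^sub>R \<omega> u) \<bullet> (y - z))"
    by (simp add: fun_eq_iff g_def inner_diff_left diff_divide_distrib left_diff_distrib)
  have gint: "integrable \<kappa> g" unfolding g by (rule integrable_inner_left[OF int])
  have "(\<integral>u. g u \<partial>\<kappa>) = (transport y - transport z) \<bullet> (y - z)"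
    unfolding g transport_def using integral_inner_left[OF int]
      Bochner_Integration.integral_diff[OF integrable_transport integrable_transport]
    by simp
  then have "(\<integral>u. g u \<partial>\<kappa>) = 0" using eq by simp
  moreover have "0 \<le> g u" if "u \<in> space \<kappa>" for u
  proof -
    have "0 \<le> (\<tau> (\<omega> u \<bullet> y) - \<tau> (\<omega> u \<bullet> z)) * (\<omega> u \<bullet> y - \<omega> u \<bullet> z)"
      using tau_strict_mono by (cases "\<omega> u \<bullet> y" "\<omega> u \<bullet> z" rule: linorder_cases)
        (auto simp: zero_le_mult_iff strict_mono_less_eq)
    then show ?thesis using inner_e_pos[OF that] by (simp add: g_def inner_diff_right)
  qed
  ultimately have "AE u in \<kappa>. g u = 0"
    using integral_nonneg_eq_0_iff_AE[OF gint] by auto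
  then have "AE u in \<kappa>. (\<omega> u \<bullet> (y - z)) * (\<omega> u \<bullet> (y - z)) = 0"
    using AE_space
  proof eventually_elim
    case (elim u)
    then have "\<tau> (\<omega> u \<bullet> y) = \<tau> (\<omega> u \<bullet> z) \<or> \<omega> u \<bullet> (y - z) = 0"
      using inner_e_pos[of u] by (auto simp: g_def)
    then show ?case
      using strict_mono_eq[OF tau_strict_mono] by (auto simp: inner_diff_right)
  qed
  then have "(\<integral>u. (\<omega> u \<bullet> (y - z)) * (\<omega> u \<bullet> (y - z)) \<partial>\<kappa>) = 0"
    by (rule integral_eq_zero_AE)
  then show "y = z" using isotropy[of "y - z" "y - z"] by simp
qed

end

section \<open>Change of variables and the Gaussian density\<close>

lemma integral_over_injective_image:
  fixes F :: "real^'m::{finite,wellorder} \<Rightarrow> real" and g :: "real^'m::_ \<Rightarrow> real^'m::_"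
  assumes g: "\<And>x. (g has_derivative g' x) (at x)" and inj: "inj g"
    and F: "F absolutely_integrable_on (range g)"
  shows "(\<lambda>x. \<bar>det (matrix (g' x))\<bar> * F (g x)) absolutely_integrable_on UNIV"
    and "integral UNIV (\<lambda>x. \<bar>det (matrix (g' x))\<bar> * F (g x)) = integral (range g) F"
proof -
  let ?F = "\<lambda>x. vec (F x) :: real^1"
  have "?F absolutely_integrable_on range g \<and> integral (range g) ?F = vec (integral (range g) F)"
    using F by (simp add: absolutely_integrable_on_1_iff integral_on_1_eq)
  then have "(\<lambda>x. \<bar>det (matrix (g' x))\<bar> *\<^sub>R ?F (g x)) absolutely_integrable_on UNIV \<and>
      integral UNIV (\<lambda>x. \<bar>det (matrix (g' x))\<bar> *\<^sub>R ?F (g x)) = vec (integral (range g) F)"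
    using has_absolute_integral_change_of_variables[of UNIV g g' ?F "vec (integral (range g) F)"] g inj
    by simp
  then show "(\<lambda>x. \<bar>det (matrix (g' x))\<bar> * F (g x)) absolutely_integrable_on UNIV"
    and "integral UNIV (\<lambda>x. \<bar>det (matrix (g' x))\<bar> * F (g x)) = integral (range g) F"
    by (simp_all add: absolutely_integrable_on_1_iff integral_on_1_eq vec_eq_iff)
qed

definition gaussian :: "'a::euclidean_space \<Rightarrow> real" where
  "gaussian y = exp (- ((norm y)\<^sup>2 / 2) - real DIM('a) * ln (2 * pi) / 2)"

lemma gaussian_eq_prod: "gaussian (y::'a::euclidean_space) = (\<Prod>b\<in>Basis. std_normal_density (y \<bullet> b))"
proof -
  have "std_normal_density s = exp (- (s\<^sup>2 / 2) - ln (2 * pi) / 2)" for s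
    by (simp add: normal_density_def exp_diff ln_sqrt[symmetric])
  then have "(\<Prod>b\<in>Basis. std_normal_density (y \<bullet> b)) = exp (\<Sum>b\<in>Basis. - ((y \<bullet> b)\<^sup>2 / 2) - ln (2 * pi) / 2)"
    by (simp add: exp_sum)
  also have "(\<Sum>b\<in>Basis. - ((y \<bullet> b)\<^sup>2 / 2) - ln (2 * pi) / 2) = - ((norm y)\<^sup>2 / 2) - real DIM('a) * ln (2 * pi) / 2"
  proof -
    have "(\<Sum>b\<in>Basis. (y \<bullet> b)\<^sup>2) = (norm y)\<^sup>2"
      unfolding power2_norm_eq_inner by (subst euclidean_inner) (simp add: power2_eq_square)
    then show ?thesis by (simp add: sum_subtractf sum_negf sum_divide_distrib[symmetric])
  qed
  finally show ?thesis by (simp add: gaussian_def)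
qed

lemma gaussian_measurable [measurable]: "gaussian \<in> borel_measurable borel"
  unfolding gaussian_def[abs_def] by measurable

lemma has_bochner_integral_gaussian:
  "has_bochner_integral lborel (gaussian :: 'a::euclidean_space \<Rightarrow> real) 1"
proof (rule has_bochner_integral_nn_integral)
  have "(\<integral>\<^sup>+ y. ennreal (gaussian y) \<partial>(lborel :: 'a measure)) =
      (\<integral>\<^sup>+ y. (\<Prod>b\<in>Basis. ennreal (std_normal_density (y \<bullet> b))) \<partial>(lborel :: 'a measure))"
    by (simp add: gaussian_eq_prod prod_ennreal)
  also have "\<dots> = (\<Prod>b\<in>(Basis::'a set). (\<integral>\<^sup>+ s. ennreal (std_normal_density s) \<partial>lborel))"
    by (rule nn_integral_lborel_prod) auto
  also have "(\<integral>\<^sup>+ s. ennreal (std_normal_density s) \<partial>lborel) = 1"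
    using prob_space.emeasure_space_1[OF prob_space_normal_density[of 1 0]]
    by (simp add: emeasure_density)
  finally show "(\<integral>\<^sup>+ y. ennreal (gaussian y) \<partial>(lborel :: 'a measure)) = ennreal 1" by simp
qed (auto simp: gaussian_def)

context cone_transport
begin

lemma measure_eq_dim: "measure \<kappa> (space \<kappa>) = real CARD('m)"
proof -
  have "measure \<kappa> (space \<kappa>) = (\<integral>u. 1 \<partial>\<kappa>)" by simp
  also have "\<dots> = (\<integral>u. (\<Sum>b\<in>Basis. (\<omega> u \<bullet> b) * (\<omega> u \<bullet> b)) \<partial>\<kappa>)"
    by (intro Bochner_Integration.integral_cong refl)
       (simp add: euclidean_inner[symmetric] norm_omega norm_eq_1[symmetric])
  also have "\<dots> = (\<Sum>b\<in>Basis. (\<integral>u. (\<omega> u \<bullet> b) * (\<omega> u \<bullet> b) \<partial>\<kappa>))"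
    using integrable_weight_inner[of "\<lambda>_. 1" 1] by (intro Bochner_Integration.integral_sum) simp
  also have "\<dots> = real CARD('m)" by (simp add: isotropy)
  finally show ?thesis .
qed

lemma integrable_tau: "integrable \<kappa> (\<lambda>u. \<tau> (\<omega> u \<bullet> y))"
proof -
  obtain T where T: "\<And>s. \<bar>s\<bar> \<le> norm y \<Longrightarrow> \<bar>\<tau> s\<bar> \<le> T"
    using continuous_bounded_on_interval[OF tau_cont] by blast
  then show ?thesis
    using abs_inner_omega_le by (intro bounded_integrable[of _ T]) auto
qed

lemma transport_inner_e: "transport y \<bullet> e = (\<integral>u. \<tau> (\<omega> u \<bullet> y) \<partial>\<kappa>)"
proof -
  have "transport y \<bullet> e = (\<integral>u. (\<tau> (\<omega> u \<bullet> y) / (\<omega> u \<bullet> e)) *\<^sub>R \<omega> u \<bullet> e \<partial>\<kappa>)"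
    unfolding transport_def by (rule integral_inner_left[symmetric]) (rule integrable_transport)
  also have "\<dots> = (\<integral>u. \<tau> (\<omega> u \<bullet> y) \<partial>\<kappa>)"
    using inner_e_pos by (intro Bochner_Integration.integral_cong refl) (auto simp: less_imp_neq[THEN not_sym])
  finally show ?thesis .
qed

lemma ln_inner_e_bound: "u \<in> space \<kappa> \<Longrightarrow> \<bar>ln (\<omega> u \<bullet> e)\<bar> \<le> \<bar>ln \<delta>\<bar>"
  using ln_mono[OF inner_e[of u] delta_pos] inner_e_le_1[of u] inner_e_pos[of u] by simp

lemma integrable_ln_inner_e: "integrable \<kappa> (\<lambda>u. ln (\<omega> u \<bullet> e))"
  using ln_inner_e_bound by (intro bounded_integrable[of _ "\<bar>ln \<delta>\<bar>"]) auto

text \<open>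
  Jensen's inequality for the logarithm: \<open>(\<omega> \<bullet> e)\<^sup>2\<close> has integral 1 over a measure of total mass \<open>N\<close>, hence mean \<open>1 / N\<close>.
  The function \<open>gap\<close> is the defect in \<open>ln x \<le> x - 1\<close> at \<open>x = N (\<omega> \<bullet> e)\<^sup>2\<close>.
\<close>

lemma integral_ln_inner_e_le:
  shows "(\<integral>u. ln (\<omega> u \<bullet> e) \<partial>\<kappa>) \<le> - (real CARD('m) / 2 * ln (real CARD('m)))"
    and "(\<integral>u. ln (\<omega> u \<bullet> e) \<partial>\<kappa>) = - (real CARD('m) / 2 * ln (real CARD('m))) \<Longrightarrow>
      AE u in \<kappa>. \<omega> u \<bullet> e = 1 / sqrt (real CARD('m))"
proof -
  define N where "N = real CARD('m)"
  have N: "0 < N" by (simp add: N_def)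
  define gap where "gap u = N * ((\<omega> u \<bullet> e) * (\<omega> u \<bullet> e)) - 1 - ln (N * (\<omega> u \<bullet> e)\<^sup>2)" for u
  have gap: "gap u = N * ((\<omega> u \<bullet> e) * (\<omega> u \<bullet> e)) - (1 + ln N) - 2 * ln (\<omega> u \<bullet> e)" if "u \<in> space \<kappa>" for u
    using inner_e_pos[OF that] N by (simp add: gap_def ln_mult ln_realpow)
  have nonneg: "0 \<le> gap u" if "u \<in> space \<kappa>" for u
    using inner_e_pos[OF that] N ln_le_minus_one[of "N * (\<omega> u \<bullet> e)\<^sup>2"]
    by (simp add: gap_def power2_eq_square)
  have int2: "integrable \<kappa> (\<lambda>u. (\<omega> u \<bullet> e) * (\<omega> u \<bullet> e))"
    using integrable_weight_inner[of "\<lambda>_. 1" 1 e e] by simp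
  have int: "integrable \<kappa> gap"
    by (subst Bochner_Integration.integrable_cong[OF refl gap])
       (auto intro!: Bochner_Integration.integrable_diff integrable_mult_right int2 integrable_ln_inner_e)
  have "(\<integral>u. gap u \<partial>\<kappa>) = (\<integral>u. N * ((\<omega> u \<bullet> e) * (\<omega> u \<bullet> e)) - (1 + ln N) - 2 * ln (\<omega> u \<bullet> e) \<partial>\<kappa>)"
    by (intro Bochner_Integration.integral_cong refl gap)
  also have "\<dots> = N * 1 - N * (1 + ln N) - 2 * (\<integral>u. ln (\<omega> u \<bullet> e) \<partial>\<kappa>)"
    using int2 integrable_ln_inner_e measure_eq_dim isotropy[of e e] norm_e
    by (simp add: Bochner_Integration.integral_diff norm_eq_1 N_def)
  finally have val: "(\<integral>u. gap u \<partial>\<kappa>) = - (N * ln N) - 2 * (\<integral>u. ln (\<omega> u \<bullet> e) \<partial>\<kappa>)"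
    by (simp add: algebra_simps)
  have "0 \<le> (\<integral>u. gap u \<partial>\<kappa>)" using nonneg by (intro Bochner_Integration.integral_nonneg) auto
  then show "(\<integral>u. ln (\<omega> u \<bullet> e) \<partial>\<kappa>) \<le> - (real CARD('m) / 2 * ln (real CARD('m)))"
    using val by (simp add: N_def)
  assume "(\<integral>u. ln (\<omega> u \<bullet> e) \<partial>\<kappa>) = - (real CARD('m) / 2 * ln (real CARD('m)))"
  then have "(\<integral>u. gap u \<partial>\<kappa>) = 0" using val by (simp add: N_def)
  then have "AE u in \<kappa>. gap u = 0" using integral_nonneg_eq_0_iff_AE[OF int] nonneg by auto
  then show "AE u in \<kappa>. \<omega> u \<bullet> e = 1 / sqrt (real CARD('m))"
    using AE_space
  proof eventually_elim
    case (elim u)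
    have "N * (\<omega> u \<bullet> e)\<^sup>2 = 1"
      using elim inner_e_pos[of u] N by (intro ln_eq_minus_one) (auto simp: gap_def power2_eq_square)
    then have "(\<omega> u \<bullet> e)\<^sup>2 = (1 / sqrt N)\<^sup>2" using N by (simp add: field_simps)
    then show ?case using inner_e_pos[OF elim(2)] N by (simp add: N_def power2_eq_iff_nonneg)
  qed
qed

text \<open>
  By the equation of \<open>\<tau>\<close>, the lower bound \<open>exp(\<integral> ln t d\<kappa>)\<close> for the Jacobian times \<open>exp(- \<Phi>(y) \<bullet> e)\<close> has exponent
  \<open>- \<integral> (\<omega> \<bullet> y)\<^sup>2 / 2 d\<kappa> - N ln(2 \<pi>) / 2 - \<integral> ln (\<omega> \<bullet> e) d\<kappa>\<close>. Isotropy turns the first integral into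
  \<open>|y|\<^sup>2 / 2\<close>, so this is a multiple of the Gaussian density. Equality forces equality in both of the inequalities used.
\<close>

lemma transported_density_ge:
  defines "D \<equiv> \<lambda>y. \<bar>det (matrix (frame_map (weight y)))\<bar> * exp (- (transport y \<bullet> e))"
  shows "real CARD('m) powr (real CARD('m) / 2) * gaussian y \<le> D y" (is ?ineq)
    and "D y = real CARD('m) powr (real CARD('m) / 2) * gaussian y \<Longrightarrow>
      (AE u in \<kappa>. \<omega> u \<bullet> e = 1 / sqrt (real CARD('m))) \<and>
      (AE u in \<kappa>. frame_map (weight y) (\<omega> u) = weight y u *\<^sub>R \<omega> u)" (is "?eq \<Longrightarrow> ?rigid")
proof -
  define N where "N = real CARD('m)"
  define L where "L = (\<integral>u. ln (\<omega> u \<bullet> e) \<partial>\<kappa>)"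
  obtain m K where b: "0 < m" "\<And>u. u \<in> space \<kappa> \<Longrightarrow> m \<le> weight y u" "\<And>u. u \<in> space \<kappa> \<Longrightarrow> weight y u \<le> K"
    using weight_bounds[of y] by blast
  note det = det_frame_map_ge[OF weight_measurable b]
  have sq: "(\<integral>u. (\<omega> u \<bullet> y)\<^sup>2 \<partial>\<kappa>) = (norm y)\<^sup>2" "integrable \<kappa> (\<lambda>u. (\<omega> u \<bullet> y)\<^sup>2)"
    using isotropy[of y y] integrable_weight_inner[of "\<lambda>_. 1" 1 y y]
    by (simp_all add: power2_eq_square power2_norm_eq_inner[symmetric])
  have "ln (weight y u) = \<tau> (\<omega> u \<bullet> y) - (\<omega> u \<bullet> y)\<^sup>2 / 2 - ln (2 * pi) / 2 - ln (\<omega> u \<bullet> e)"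
    if "u \<in> space \<kappa>" for u
    using inner_e_pos[OF that] tau'_pos[of "\<omega> u \<bullet> y"] tau_ode[of "\<omega> u \<bullet> y"]
    by (simp add: weight_def ln_div)
  then have "(\<integral>u. ln (weight y u) \<partial>\<kappa>) =
     (\<integral>u. \<tau> (\<omega> u \<bullet> y) - (\<omega> u \<bullet> y)\<^sup>2 / 2 - ln (2 * pi) / 2 - ln (\<omega> u \<bullet> e) \<partial>\<kappa>)"
    by (intro Bochner_Integration.integral_cong refl)
  also have "\<dots> = (\<integral>u. \<tau> (\<omega> u \<bullet> y) \<partial>\<kappa>) - (norm y)\<^sup>2 / 2 - N * (ln (2 * pi) / 2) - L"
    using integrable_tau[of y] sq integrable_ln_inner_e measure_eq_dim
    by (simp add: Bochner_Integration.integral_diff N_def L_def)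
  finally have exponent: "exp (\<integral>u. ln (weight y u) \<partial>\<kappa>) * exp (- (transport y \<bullet> e)) = exp (- L) * gaussian y"
    by (simp add: transport_inner_e gaussian_def N_def exp_add[symmetric] exp_diff[symmetric])
  have powr: "N powr (N / 2) = exp (N / 2 * ln N)" by (simp add: powr_def N_def)
  have gpos: "0 < gaussian y" by (simp add: gaussian_def)
  have step1: "N powr (N / 2) * gaussian y \<le> exp (- L) * gaussian y"
    using integral_ln_inner_e_le(1) gpos unfolding powr by (simp add: N_def L_def)
  have detpos: "0 < det (matrix (frame_map (weight y)))"
    using det(1) by (meson exp_gt_zero less_le_trans)
  have step2: "exp (- L) * gaussian y \<le> D y"
    unfolding exponent[symmetric] D_def using det(1) by (intro mult_right_mono) auto
  from step1 step2 show ?ineq by (simp add: N_def)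
  assume ?eq
  then have eq1: "N powr (N / 2) * gaussian y = exp (- L) * gaussian y" and eq2: "exp (- L) * gaussian y = D y"
    using step1 step2 unfolding N_def by linarith+
  from eq1 have "L = - (N / 2 * ln N)" using gpos unfolding powr by simp
  then have "AE u in \<kappa>. \<omega> u \<bullet> e = 1 / sqrt (real CARD('m))"
    unfolding L_def N_def by (rule integral_ln_inner_e_le(2))
  moreover have "exp (\<integral>u. ln (weight y u) \<partial>\<kappa>) = det (matrix (frame_map (weight y)))"
    using eq2 detpos unfolding exponent[symmetric] D_def by simp
  ultimately show ?rigid using det(2) by simp
qed

end

section \<open>The lower bound for cone integrals\<close>

text \<open>
  The set where a continuous equation fails is open; if it is a null set, it misses the support.
\<close>

lemma msupport_AE_zero:
  fixes X :: "'b \<Rightarrow> 'a::topological_space" and g :: "'a \<Rightarrow> 'c::t1_space"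
  assumes X [measurable]: "X \<in> borel_measurable M" and x: "x \<in> msupport (distr M borel X)"
    and g: "continuous_on UNIV g" and AE: "AE u in M. g (X u) = z"
  shows "g x = z"
proof (rule ccontr)
  assume "g x \<noteq> z"
  define U where "U = g -` (- {z})"
  have "open U" unfolding U_def using g by (simp add: continuous_on_open_vimage open_Compl)
  then have U [measurable]: "U \<in> sets borel" by simp
  have "emeasure (distr M borel X) U > 0"
    using x \<open>open U\<close> \<open>g x \<noteq> z\<close> by (auto simp: msupport_def U_def)
  moreover have "emeasure (distr M borel X) U = emeasure M (X -` U \<inter> space M)"
    by (simp add: emeasure_distr)
  moreover have "emeasure M {u \<in> space M. X u \<in> U} = 0"
    by (rule emeasure_eq_0_AE) (use AE in eventually_elim, simp add: U_def)
  moreover have "X -` U \<inter> space M = {u \<in> space M. X u \<in> U}" by auto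
  ultimately show False by simp
qed

context cone_transport
begin

text \<open>
  The integral over \<open>C\<close> is at least the one over the range of the transport map, which is the integral of the transported
  density. In the case of equality this density agrees almost everywhere with its lower bound; it suffices to know this at
  one point of each nonempty open set.
\<close>

theorem cone_integral_ge:
  assumes C: "C \<in> sets lebesgue" and range: "range transport \<subseteq> C"
    and int: "(\<lambda>x. exp (- (x \<bullet> e))) absolutely_integrable_on C"
  shows "real CARD('m) powr (real CARD('m) / 2) \<le> integral C (\<lambda>x. exp (- (x \<bullet> e)))" (is ?ineq)
    and "integral C (\<lambda>x. exp (- (x \<bullet> e))) = real CARD('m) powr (real CARD('m) / 2) \<Longrightarrow> open Y \<Longrightarrow> Y \<noteq> {} \<Longrightarrow>
      \<exists>y\<in>Y. (AE u in \<kappa>. \<omega> u \<bullet> e = 1 / sqrt (real CARD('m))) \<and>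
          (AE u in \<kappa>. frame_map (weight y) (\<omega> u) = weight y u *\<^sub>R \<omega> u)"
      (is "?eq \<Longrightarrow> _ \<Longrightarrow> _ \<Longrightarrow> ?rigid")
proof -
  let ?E = "\<lambda>x. exp (- (x \<bullet> e))"
  let ?N = "real CARD('m) powr (real CARD('m) / 2)"
  define D where "D y = \<bar>det (matrix (frame_map (weight y)))\<bar> * exp (- (transport y \<bullet> e))" for y
  have "transport differentiable_on UNIV"
    using transport_deriv by (meson differentiable_at_imp_differentiable_on differentiable_def)
  then have meas: "range transport \<in> sets lebesgue"
    by (intro differentiable_image_in_sets_lebesgue) auto
  have intR: "?E absolutely_integrable_on range transport"
    using set_integrable_subset[OF int meas range] .
  note cov = integral_over_injective_image[OF transport_deriv transport_inj intR, folded D_def]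
  have "integral UNIV D = integral (range transport) ?E" by (rule cov(2))
  also have "\<dots> \<le> integral C ?E"
    using intR int range by (intro integral_subset_le) (auto simp: absolutely_integrable_on_def)
  finally have DC: "integral UNIV D \<le> integral C ?E" .
  have D: "integrable lebesgue D" "integral\<^sup>L lebesgue D = integral UNIV D"
    using cov(1) set_lebesgue_integral_eq_integral(2)[OF cov(1)]
    by (simp_all add: set_integrable_def set_lebesgue_integral_def)
  have G: "integrable lebesgue (\<lambda>y. ?N * gaussian (y :: real^'m::_))"
    "integral\<^sup>L lebesgue (\<lambda>y. ?N * gaussian (y :: real^'m::_)) = ?N"
    using has_bochner_integral_gaussian[where 'a = "real^'m::_"]
    by (simp_all add: has_bochner_integral_iff integrable_completion integral_completion)
  have le: "?N * gaussian y \<le> D y" for y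
    unfolding D_def by (rule transported_density_ge(1))
  have "?N \<le> integral\<^sup>L lebesgue D"
    using integral_mono[OF G(1) D(1) le] G(2) by simp
  then show ?ineq using DC D(2) by simp
  assume ?eq and Y: "open Y" "Y \<noteq> {}"
  have "integral\<^sup>L lebesgue (\<lambda>y. D y - ?N * gaussian y) = 0"
    using DC D G \<open>?N \<le> integral\<^sup>L lebesgue D\<close> \<open>?eq\<close> by (simp add: Bochner_Integration.integral_diff)
  then have AE: "AE y in lebesgue. D y - ?N * gaussian y = 0"
    using integral_nonneg_eq_0_iff_AE[OF Bochner_Integration.integrable_diff[OF D(1) G(1)]] le by simp
  have "\<exists>y\<in>Y. D y = ?N * gaussian y"
  proof (rule ccontr)
    assume "\<not> ?thesis"
    then have "AE y in lebesgue. y \<in> - Y"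
      using AE by (auto elim!: eventually_mono)
    then have "AE y \<in> UNIV in lebesgue. y \<in> - Y" by simp
    from mem_closed_if_AE_lebesgue_open[OF open_UNIV _ this] Y show False by auto
  qed
  then show ?rigid using transported_density_ge(2) unfolding D_def by blast
qed

text \<open>
  Two distinct support vectors \<open>x\<close> and \<open>z\<close> are unit vectors of the same positive height, hence are linearly independent, so the numbers
  \<open>x \<bullet> y\<close> and \<open>z \<bullet> y\<close> can be prescribed. On an open set of \<open>y\<close> the values of \<open>\<tau>'\<close> at them differ, and \<open>x\<close>, \<open>z\<close> become
  eigenvectors of one symmetric map with different eigenvalues.
\<close>

theorem cone_integral_eq_imp_orthogonal:
  assumes C: "C \<in> sets lebesgue" and range: "range transport \<subseteq> C"
    and int: "(\<lambda>x. exp (- (x \<bullet> e))) absolutely_integrable_on C"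
    and eq: "integral C (\<lambda>x. exp (- (x \<bullet> e))) = real CARD('m) powr (real CARD('m) / 2)"
    and nonconst: "\<tau>' s1 \<noteq> \<tau>' s2"
    and x: "x \<in> msupport (distr \<kappa> borel \<omega>)"
  shows "x \<bullet> e = 1 / sqrt (real CARD('m))"
    and "z \<in> msupport (distr \<kappa> borel \<omega>) \<Longrightarrow> x \<noteq> z \<Longrightarrow> x \<bullet> z = 0"
proof -
  note rigid = cone_integral_ge(2)[OF C range int eq]
  have height: "AE u in \<kappa>. \<omega> u \<bullet> e = 1 / sqrt (real CARD('m))"
    using rigid[OF open_UNIV] by auto
  have supp_height: "w \<bullet> e = 1 / sqrt (real CARD('m))" if "w \<in> msupport (distr \<kappa> borel \<omega>)" for w
    by (rule msupport_AE_zero[OF omega_measurable that _ height]) (intro continuous_intros)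
  from supp_height[OF x] show "x \<bullet> e = 1 / sqrt (real CARD('m))" .
  have supp_norm: "norm w = 1" if "w \<in> msupport (distr \<kappa> borel \<omega>)" for w
    by (rule msupport_AE_zero[OF omega_measurable that]) (auto intro!: continuous_intros norm_omega)
  assume z: "z \<in> msupport (distr \<kappa> borel \<omega>)" and ne: "x \<noteq> z"
  define Y where "Y = {y. \<tau>' (x \<bullet> y) - \<tau>' (z \<bullet> y) \<noteq> 0}"
  have ct: "continuous_on UNIV (\<lambda>y. \<tau>' (w \<bullet> y))" for w :: "real^'m::_"
    by (intro continuous_on_compose2[OF tau'_cont]) (auto intro!: continuous_intros)
  have "open Y" unfolding Y_def
    by (intro open_Collect_neq continuous_intros ct)
  moreover have "Y \<noteq> {}"
  proof -
    define \<alpha> where "\<alpha> = x \<bullet> z"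
    have xx: "x \<bullet> x = 1" "z \<bullet> z = 1" using supp_norm[OF x] supp_norm[OF z] by (simp_all add: norm_eq_1)
    have "\<alpha> \<noteq> 1"
    proof
      assume "\<alpha> = 1"
      then have "(x - z) \<bullet> (x - z) = 0" using xx by (simp add: \<alpha>_def inner_diff_left inner_diff_right inner_commute)
      then show False using ne by simp
    qed
    moreover have "\<alpha> \<noteq> - 1"
    proof
      assume "\<alpha> = - 1"
      then have "(x + z) \<bullet> (x + z) = 0" using xx by (simp add: \<alpha>_def inner_add_left inner_add_right inner_commute)
      then have "x = - z" by (simp add: eq_neg_iff_add_eq_0)
      then show False using supp_height[OF x] supp_height[OF z] by simp
    qed
    ultimately have \<alpha>: "1 - \<alpha>\<^sup>2 \<noteq> 0" by (simp add: power2_eq_1_iff)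
    \<comment> \<open>The solution of the two linear equations \<open>x \<bullet> y = s1\<close> and \<open>z \<bullet> y = s2\<close> in the span of \<open>x\<close> and \<open>z\<close>.\<close>
    define y where "y = ((s1 - \<alpha> * s2) / (1 - \<alpha>\<^sup>2)) *\<^sub>R x + ((s2 - \<alpha> * s1) / (1 - \<alpha>\<^sup>2)) *\<^sub>R z"
    have "x \<bullet> y = ((s1 - \<alpha> * s2) + (s2 - \<alpha> * s1) * \<alpha>) / (1 - \<alpha>\<^sup>2)"
      by (simp add: y_def inner_add_right xx \<alpha>_def[symmetric] add_divide_distrib)
    also have "\<dots> = s1" using \<alpha> by (simp add: divide_eq_eq) (simp add: algebra_simps power2_eq_square)
    finally have 1: "x \<bullet> y = s1" .
    have "z \<bullet> y = ((s1 - \<alpha> * s2) * \<alpha> + (s2 - \<alpha> * s1)) / (1 - \<alpha>\<^sup>2)"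
      by (simp add: y_def inner_add_right xx \<alpha>_def[symmetric] inner_commute[of z x] add_divide_distrib)
    also have "\<dots> = s2" using \<alpha> by (simp add: divide_eq_eq) (simp add: algebra_simps power2_eq_square)
    finally have "z \<bullet> y = s2" .
    with 1 nonconst have "y \<in> Y" by (simp add: Y_def)
    then show ?thesis by blast
  qed
  ultimately obtain y where y: "y \<in> Y"
    and eig: "AE u in \<kappa>. frame_map (weight y) (\<omega> u) = weight y u *\<^sub>R \<omega> u"
    using rigid by blast
  define k where "k = sqrt (real CARD('m))"
  have k: "k > 0" by (simp add: k_def)
  have lin: "linear (frame_map (weight y))" by (rule linear_frame_map_weight)
  have contA: "continuous_on UNIV (frame_map (weight y))"
    using lin linear_continuous_on linear_conv_bounded_linear by blast
  have "AE u in \<kappa>. frame_map (weight y) (\<omega> u) - (k * \<tau>' (\<omega> u \<bullet> y)) *\<^sub>R \<omega> u = 0"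
    using eig height by eventually_elim (simp add: weight_def k_def)
  then have supp_eig: "frame_map (weight y) w - (k * \<tau>' (w \<bullet> y)) *\<^sub>R w = 0"
    if "w \<in> msupport (distr \<kappa> borel \<omega>)" for w
    by (rule msupport_AE_zero[OF omega_measurable that, rotated])
       (intro continuous_intros contA continuous_on_compose2[OF tau'_cont] subset_UNIV)
  have "frame_map (weight y) x \<bullet> z = x \<bullet> frame_map (weight y) z"
    by (rule frame_map_weight_symmetric)
  then have "(k * (\<tau>' (x \<bullet> y) - \<tau>' (z \<bullet> y))) * (x \<bullet> z) = 0"
    using supp_eig[OF x] supp_eig[OF z] by (simp add: algebra_simps)
  then show "x \<bullet> z = 0" using k y by (simp add: Y_def)
qed

end

section \<open>The simplicial cone\<close>

lemma distr_lborel_orthogonal: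
  fixes T :: "real^'m::{finite,wellorder} \<Rightarrow> real^'m::_"
  assumes T: "orthogonal_transformation T"
  shows "distr lborel borel T = lborel"
proof (rule lborel_eqI[symmetric])
  have lin: "linear T" using T by (rule orthogonal_transformation_linear)
  have [measurable]: "T \<in> borel_measurable borel"
    using lin linear_continuous_on linear_conv_bounded_linear
    by (intro borel_measurable_continuous_onI) blast
  fix l u :: "real^'m::_"
  assume le: "\<And>b. b \<in> Basis \<Longrightarrow> l \<bullet> b \<le> u \<bullet> b"
  have invT: "orthogonal_transformation (inv T)" by (rule orthogonal_transformation_inv[OF T])
  have bij: "bij T" by (rule orthogonal_transformation_bij[OF T])
  have img: "T -` box l u = inv T ` box l u" by (rule bij_vimage_eq_inv_image[OF bij])
  have m: "T -` box l u \<in> lmeasurable"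
    unfolding img by (rule measurable_orthogonal_image[OF invT]) simp
  have "T -` box l u \<in> sets borel" using measurable_sets_borel[of T borel "box l u"] by simp
  then have "emeasure (distr lborel borel T) (box l u) = emeasure lebesgue (T -` box l u)"
    by (simp add: emeasure_distr)
  also have "\<dots> = ennreal (measure lebesgue (T -` box l u))"
    using m by (simp add: emeasure_eq_measure2)
  also have "measure lebesgue (T -` box l u) = measure lebesgue (box l u)"
    unfolding img by (rule measure_orthogonal_image[OF invT]) simp
  also have "ennreal (measure lebesgue (box l u)) = (\<Prod>b\<in>Basis. (u - l) \<bullet> b)"
    using le by (simp add: measure_completion measure_lborel_box_eq)
  finally show "emeasure (distr lborel borel T) (box l u) = (\<Prod>b\<in>Basis. (u - l) \<bullet> b)" .
qed simp

lemma nn_integral_prod_orthonormal_basis: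
  fixes B :: "(real^'m::{finite,wellorder}) set"
  assumes B: "orthonormal_basis B" and g [measurable]: "g \<in> borel_measurable borel"
  shows "(\<integral>\<^sup>+ x. (\<Prod>b\<in>B. g (x \<bullet> b)) \<partial>lborel) = (\<integral>\<^sup>+ s. g s \<partial>lborel) ^ CARD('m)"
proof -
  have "card (Basis :: (real^'m::_) set) = card B" using orthonormal_basis_card[OF B] by simp
  then obtain k where k: "bij_betw k (Basis :: (real^'m::_) set) B"
    using finite_same_card_bij[OF finite_Basis orthonormal_basis_finite[OF B]] by blast
  have kB: "k c \<in> B" if "c \<in> Basis" for c using k that by (auto simp: bij_betw_def)
  have kinner: "k c \<bullet> k c' = (if c = c' then 1 else 0)" if "c \<in> Basis" "c' \<in> Basis" for c c'
    using orthonormal_basis_inner[OF B kB kB, OF that] k that by (auto simp: bij_betw_def inj_on_def)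
  define T where "T x = (\<Sum>c\<in>Basis. (x \<bullet> c) *\<^sub>R k c)" for x :: "real^'m::_"
  have Tk: "T x \<bullet> k c = x \<bullet> c" if "c \<in> Basis" for x c
  proof -
    have "T x \<bullet> k c = (\<Sum>c'\<in>Basis. (x \<bullet> c') * (if c' = c then 1 else 0))"
      unfolding T_def inner_sum_left inner_scaleR_left
      by (intro sum.cong refl arg_cong2[where f = "(*)"] kinner that)
    then show ?thesis using that by (simp add: if_distrib cong: if_cong)
  qed
  have T: "orthogonal_transformation T"
    unfolding orthogonal_transformation_def
  proof (intro conjI allI)
    show "linear T" unfolding T_def
      by (intro linear_compose_sum ballI linearI) (auto simp: algebra_simps)
    fix v w
    have "T v \<bullet> T w = (\<Sum>b\<in>B. (T v \<bullet> b) * (T w \<bullet> b))" by (rule orthonormal_basis_parseval[OF B])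
    also have "\<dots> = (\<Sum>c\<in>Basis. (T v \<bullet> k c) * (T w \<bullet> k c))"
      by (rule sum.reindex_bij_betw[OF k, symmetric])
    also have "\<dots> = v \<bullet> w" by (simp add: Tk euclidean_inner[of v w])
    finally show "T v \<bullet> T w = v \<bullet> w" .
  qed
  have lin: "linear T" using T by (rule orthogonal_transformation_linear)
  have [measurable]: "T \<in> borel_measurable borel"
    using lin linear_continuous_on linear_conv_bounded_linear
    by (intro borel_measurable_continuous_onI) blast
  have "(\<integral>\<^sup>+ x. (\<Prod>b\<in>B. g (x \<bullet> b)) \<partial>lborel) = (\<integral>\<^sup>+ x. (\<Prod>b\<in>B. g (T x \<bullet> b)) \<partial>lborel)"
    by (subst distr_lborel_orthogonal[OF T, symmetric], subst nn_integral_distr) auto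
  also have "\<dots> = (\<integral>\<^sup>+ x. (\<Prod>c\<in>Basis. g (x \<bullet> c)) \<partial>(lborel :: (real^'m::_) measure))"
    by (simp add: prod.reindex_bij_betw[OF k, symmetric] Tk)
  also have "\<dots> = (\<Prod>c\<in>(Basis :: (real^'m::_) set). (\<integral>\<^sup>+ s. g s \<partial>lborel))"
    by (rule nn_integral_lborel_prod) auto
  finally show ?thesis by simp
qed

text \<open>
  In the coordinates \<open>x \<bullet> b\<close> of the basis, \<open>exp(- x \<bullet> e)\<close> restricted to the orthant is a multiple of a product of
  exponential densities of rate \<open>1 / \<surd>N\<close>.
\<close>

lemma integral_orthant_le:
  fixes B :: "(real^'m::{finite,wellorder}) set" and e :: "real^'m::_"
  assumes B: "orthonormal_basis B" and e: "\<And>b. b \<in> B \<Longrightarrow> e \<bullet> b = 1 / sqrt (real CARD('m))"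
    and C: "C \<in> sets borel" and sub: "\<And>x b. x \<in> C \<Longrightarrow> b \<in> B \<Longrightarrow> 0 \<le> x \<bullet> b"
    and int: "(\<lambda>x. exp (- (x \<bullet> e))) absolutely_integrable_on C"
  shows "integral C (\<lambda>x. exp (- (x \<bullet> e))) \<le> real CARD('m) powr (real CARD('m) / 2)"
proof -
  define N where "N = real CARD('m)"
  have N: "N > 0" by (simp add: N_def)
  define l where "l = 1 / sqrt N"
  have l: "0 < l" using N by (simp add: l_def)
  note [measurable] = C
  have pw: "(1 / l) ^ CARD('m) = N powr (N / 2)"
    using N by (simp add: l_def N_def powr_half_sqrt[symmetric] powr_realpow[symmetric] powr_powr)
  have le: "indicator C x *\<^sub>R exp (- (x \<bullet> e)) \<le> N powr (N / 2) * (\<Prod>b\<in>B. exponential_density l (x \<bullet> b))" for x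
  proof (cases "x \<in> C")
    case True
    have "(\<Prod>b\<in>B. exponential_density l (x \<bullet> b)) = (\<Prod>b\<in>B. l * exp (- ((x \<bullet> b) * l)))"
      by (intro prod.cong refl) (force simp: exponential_density_def dest: sub[OF True])
    also have "\<dots> = l ^ CARD('m) * exp (- (\<Sum>b\<in>B. (x \<bullet> b) * l))"
      using orthonormal_basis_card[OF B] orthonormal_basis_finite[OF B]
      by (simp add: prod.distrib exp_sum sum_negf[symmetric])
    also have "(\<Sum>b\<in>B. (x \<bullet> b) * l) = x \<bullet> e"
      unfolding orthonormal_basis_parseval[OF B, of x e] by (intro sum.cong refl) (simp add: e l_def N_def)
    finally have "N powr (N / 2) * (\<Prod>b\<in>B. exponential_density l (x \<bullet> b)) = exp (- (x \<bullet> e))"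
      using l unfolding pw[symmetric] by (simp add: power_divide)
    then show ?thesis using True by simp
  next
    case False
    then show ?thesis using l by (auto intro!: prod_nonneg mult_nonneg_nonneg simp: exponential_density_def)
  qed
  have dens: "(\<integral>\<^sup>+ s. ennreal (exponential_density l s) \<partial>lborel) = 1"
    using prob_space.emeasure_space_1[OF prob_space_exponential_density[OF l]]
    by (simp add: emeasure_density)
  have "(\<integral>\<^sup>+ x. ennreal (indicator C x *\<^sub>R exp (- (x \<bullet> e))) \<partial>lborel)
     \<le> (\<integral>\<^sup>+ x. ennreal (N powr (N / 2)) * (\<Prod>b\<in>B. ennreal (exponential_density l (x \<bullet> b))) \<partial>lborel)"
  proof (rule nn_integral_mono)
    fix x
    have "(\<Prod>b\<in>B. ennreal (exponential_density l (x \<bullet> b))) = ennreal (\<Prod>b\<in>B. exponential_density l (x \<bullet> b))"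
      using l by (intro prod_ennreal) (auto simp: exponential_density_def)
    then show "ennreal (indicator C x *\<^sub>R exp (- (x \<bullet> e))) \<le> ennreal (N powr (N / 2)) * (\<Prod>b\<in>B. ennreal (exponential_density l (x \<bullet> b)))"
      using le[of x] by (simp add: ennreal_mult'[symmetric] ennreal_leI)
  qed
  also have "\<dots> = ennreal (N powr (N / 2)) * (\<integral>\<^sup>+ x. (\<Prod>b\<in>B. ennreal (exponential_density l (x \<bullet> b))) \<partial>lborel)"
    by (rule nn_integral_cmult) measurable
  also have "(\<integral>\<^sup>+ x. (\<Prod>b\<in>B. ennreal (exponential_density l (x \<bullet> b))) \<partial>lborel) = 1"
    by (subst nn_integral_prod_orthonormal_basis[OF B, of "\<lambda>s. ennreal (exponential_density l s)"]) (simp_all add: dens)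
  finally have le: "(\<integral>\<^sup>+ x. ennreal (indicator C x *\<^sub>R exp (- (x \<bullet> e))) \<partial>lborel) \<le> ennreal (N powr (N / 2))" by simp
  have "integral C (\<lambda>x. exp (- (x \<bullet> e))) = (\<integral>x. indicator C x *\<^sub>R exp (- (x \<bullet> e)) \<partial>lebesgue)"
    using set_lebesgue_integral_eq_integral(2)[OF int] by (simp add: set_lebesgue_integral_def)
  also have "\<dots> = (\<integral>x. indicator C x *\<^sub>R exp (- (x \<bullet> e)) \<partial>lborel)"
    by (rule integral_completion) measurable
  also have "\<dots> = enn2real (\<integral>\<^sup>+ x. ennreal (indicator C x *\<^sub>R exp (- (x \<bullet> e))) \<partial>lborel)"
    by (rule integral_eq_nn_integral) auto
  also have "\<dots> \<le> N powr (N / 2)" using le by (simp add: enn2real_leI)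
  finally show ?thesis by (simp add: N_def)
qed

section \<open>Adding a coordinate\<close>

text \<open>
  The index type of \<open>\<real>\<^sup>n\<^sup>+\<^sup>1\<close>: one coordinate for the height and the coordinates of the base space.
\<close>

datatype 'a lifted = Height | Base 'a

lemma UNIV_lifted: "UNIV = insert Height (range Base)"
  using lifted.exhaust by auto

instance lifted :: (finite) finite
  by standard (simp add: UNIV_lifted)

text \<open>
  The change of variables formula needs a well-ordered index type. The order is arbitrary and comes from an enumeration.
\<close>

instantiation lifted :: (finite) wellorder
begin

definition "x \<le> y \<longleftrightarrow> to_nat x \<le> to_nat y" for x y :: "'a lifted"
definition "x < y \<longleftrightarrow> to_nat x < to_nat y" for x y :: "'a lifted"

instance
proof
  fix P and a :: "'a lifted"
  assume step: "\<And>x :: 'a lifted. (\<And>y. y < x \<Longrightarrow> P y) \<Longrightarrow> P x"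
  show "P a"
    by (induction a rule: measure_induct_rule[where f = to_nat]) (rule step, simp add: less_lifted_def)
qed (auto simp: less_eq_lifted_def less_lifted_def)

end

lemma sum_lifted: "(\<Sum>i\<in>UNIV. g i) = g Height + (\<Sum>j\<in>UNIV. g (Base j))"
  for g :: "'a::finite lifted \<Rightarrow> 'b::comm_monoid_add"
  unfolding UNIV_lifted by (subst sum.insert) (auto simp: sum.reindex inj_on_def)

lemma card_lifted: "CARD('a::finite lifted) = CARD('a) + 1"
  unfolding UNIV_lifted by (subst card_insert_disjoint) (auto simp: card_image inj_on_def)

definition lift :: "(real^'n) \<times> real \<Rightarrow> real^('n lifted)" where
  "lift z = (\<chi> i. case i of Height \<Rightarrow> snd z | Base j \<Rightarrow> fst z $ j)"

definition unlift :: "real^('n lifted) \<Rightarrow> (real^'n) \<times> real" where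
  "unlift x = ((\<chi> j. x $ Base j), x $ Height)"

lemma lift_nth [simp]: "lift z $ Height = snd z" "lift z $ Base j = fst z $ j"
  by (simp_all add: lift_def)

lemma unlift_lift [simp]: "unlift (lift z) = z"
  by (simp add: unlift_def prod_eq_iff vec_eq_iff)

lemma lift_unlift [simp]: "lift (unlift x) = x"
  unfolding vec_eq_iff
proof
  show "lift (unlift x) $ i = x $ i" for i by (cases i) (simp_all add: unlift_def)
qed

lemma lift_inner: "lift a \<bullet> lift b = fst a \<bullet> fst b + snd a * snd b"
  by (simp add: inner_vec_def sum_lifted)

lemma continuous_on_lift: "continuous_on UNIV (lift :: (real^'n) \<times> real \<Rightarrow> _)"
  unfolding lift_def
proof (rule continuous_on_vec_lambda)
  show "continuous_on UNIV (\<lambda>z :: (real^'n) \<times> real. case i of Height \<Rightarrow> snd z | Base j \<Rightarrow> fst z $ j)" for i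
    by (cases i) (auto intro!: continuous_intros)
qed

lemma continuous_on_unlift: "continuous_on UNIV (unlift :: real^('n::finite lifted) \<Rightarrow> _)"
  unfolding unlift_def by (intro continuous_intros continuous_on_vec_lambda)

lemma lift_measurable [measurable]: "lift \<in> borel_measurable borel"
  by (rule borel_measurable_continuous_onI[OF continuous_on_lift])

lemma unlift_measurable [measurable]:
  "(\<lambda>x. fst (unlift x)) \<in> borel_measurable borel" "(\<lambda>x. snd (unlift x)) \<in> borel_measurable borel"
  by (intro borel_measurable_continuous_onI continuous_intros continuous_on_unlift)+

text \<open>
  Boxes pull back to products of boxes with the same side lengths.
\<close>

lemma distr_lborel_lift: "distr lborel borel (lift :: (real^'n) \<times> real \<Rightarrow> _) = lborel"
proof (rule lborel_eqI[symmetric])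
  fix l u :: "real^('n lifted)"
  assume le: "\<And>b. b \<in> Basis \<Longrightarrow> l \<bullet> b \<le> u \<bullet> b"
  then have le': "l $ i \<le> u $ i" for i
    using le[of "axis i 1"] by (simp add: inner_axis axis_in_Basis_iff)
  have pre: "lift -` box l u = box (fst (unlift l)) (fst (unlift u)) \<times> box (snd (unlift l)) (snd (unlift u))"
  proof -
    have "x \<in> lift -` box l u \<longleftrightarrow> x \<in> box (fst (unlift l)) (fst (unlift u)) \<times> box (snd (unlift l)) (snd (unlift u))"
      for x :: "(real^'n) \<times> real"
    proof -
      have "(\<forall>i. l $ i < lift x $ i \<and> lift x $ i < u $ i) \<longleftrightarrow>
         (l $ Height < snd x \<and> snd x < u $ Height) \<and> (\<forall>j. l $ Base j < fst x $ j \<and> fst x $ j < u $ Base j)"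
        by (metis lifted.exhaust lift_nth)
      then show ?thesis by (cases x) (auto simp: mem_box_cart unlift_def box_real)
    qed
    then show ?thesis by blast
  qed
  have cartbox: "emeasure lborel (box a b) = (\<Prod>j\<in>UNIV. b $ j - a $ j)" if "\<And>j. a $ j \<le> b $ j" for a b :: "real^'k"
  proof -
    have "emeasure lborel (box a b) = (\<Prod>c\<in>Basis. (b - a) \<bullet> c)"
      using that by (intro emeasure_lborel_box) (auto simp: Basis_vec_def inner_axis)
    also have "(\<Prod>c\<in>Basis. (b - a) \<bullet> c) = (\<Prod>j\<in>UNIV. b $ j - a $ j)"
      by (simp add: Basis_vec_def UNION_singleton_eq_range prod.reindex inj_on_def axis_eq_axis inner_axis)
    finally show ?thesis .
  qed
  have "emeasure (distr lborel borel lift) (box l u) = emeasure lborel (lift -` box l u)"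
    by (simp add: emeasure_distr)
  also have "\<dots> = emeasure lborel (box (fst (unlift l)) (fst (unlift u))) * emeasure lborel (box (snd (unlift l)) (snd (unlift u)))"
    unfolding pre lborel_prod[symmetric] by (rule lborel.emeasure_pair_measure_Times) auto
  also have "\<dots> = ennreal (\<Prod>j\<in>UNIV. u $ Base j - l $ Base j) * ennreal (u $ Height - l $ Height)"
    using le' by (simp add: cartbox unlift_def)
  also have "\<dots> = ennreal ((\<Prod>j\<in>UNIV. u $ Base j - l $ Base j) * (u $ Height - l $ Height))"
    using le' by (intro ennreal_mult[symmetric] prod_nonneg) auto
  also have "(\<Prod>j\<in>UNIV. u $ Base j - l $ Base j) * (u $ Height - l $ Height) = (\<Prod>i\<in>UNIV. u $ i - l $ i)"
    unfolding UNIV_lifted by (subst prod.insert) (auto simp: prod.reindex inj_on_def)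
  also have "ennreal (\<Prod>i\<in>UNIV. u $ i - l $ i) = emeasure lborel (box l u)"
    using le' by (simp add: cartbox)
  also have "\<dots> = (\<Prod>b\<in>Basis. (u - l) \<bullet> b)"
    using le by (rule emeasure_lborel_box)
  finally show "emeasure (distr lborel borel lift) (box l u) = (\<Prod>b\<in>Basis. (u - l) \<bullet> b)" .
qed simp

lemma emeasure_lborel_dilation:
  fixes K :: "'a::euclidean_space set"
  assumes [measurable]: "K \<in> sets borel" and c: "0 < c"
  shows "emeasure lborel {p. p /\<^sub>R c \<in> K} = ennreal (c ^ DIM('a)) * emeasure lborel K"
proof -
  have img: "{p. p /\<^sub>R c \<in> K} = (\<lambda>x. c *\<^sub>R x + 0) ` K"
  proof -
    have "p \<in> (\<lambda>x. c *\<^sub>R x + 0) ` K" if "p /\<^sub>R c \<in> K" for p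
      using that c by (intro image_eqI[of _ _ "p /\<^sub>R c"]) auto
    then show ?thesis using c by auto
  qed
  have "{p. p /\<^sub>R c \<in> K} \<in> sets borel" by measurable
  then have "emeasure lborel {p. p /\<^sub>R c \<in> K} = emeasure lebesgue {p. p /\<^sub>R c \<in> K}" by simp
  also have "\<dots> = ennreal (\<bar>c\<bar> ^ DIM('a)) * emeasure lebesgue K"
    unfolding img by (rule emeasure_lebesgue_affine)
  finally show ?thesis using c by simp
qed

text \<open>
  The slice at height \<open>t\<close> is a dilate of \<open>K\<close> by the factor \<open>r t\<close>, which leaves the Gamma integral of \<open>t\<^sup>n exp(- t)\<close>.
\<close>

lemma nn_integral_cone:
  fixes K :: "'a::euclidean_space set"
  assumes K [measurable]: "K \<in> sets borel" and r: "0 < r"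
  shows "(\<integral>\<^sup>+ z. ennreal (exp (- snd z)) * indicator {z. 0 < snd z \<and> fst z /\<^sub>R (r * snd z) \<in> K} z \<partial>lborel)
    = ennreal (fact DIM('a) * r ^ DIM('a)) * emeasure lborel K"
proof -
  let ?n = "DIM('a)"
  have "(\<integral>\<^sup>+ z. ennreal (exp (- snd z)) * indicator {z. 0 < snd z \<and> fst z /\<^sub>R (r * snd z) \<in> K} z \<partial>lborel)
     = (\<integral>\<^sup>+ t. (\<integral>\<^sup>+ p. ennreal (exp (- t)) * indicator {z. 0 < snd z \<and> fst z /\<^sub>R (r * snd z) \<in> K} (p, t) \<partial>lborel) \<partial>lborel)"
    unfolding lborel_prod[symmetric]
    by (subst lborel_pair.nn_integral_snd[symmetric]) (auto simp: borel_prod)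
  also have "\<dots> = (\<integral>\<^sup>+ t. ennreal (t ^ ?n * exp (- t)) * indicator {0..} t * (ennreal (r ^ ?n) * emeasure lborel K) \<partial>lborel)"
  proof (rule nn_integral_cong_AE, use AE_lborel_singleton[of "0::real"] in eventually_elim)
    fix t :: real assume "t \<noteq> 0"
    show "(\<integral>\<^sup>+ p. ennreal (exp (- t)) * indicator {z. 0 < snd z \<and> fst z /\<^sub>R (r * snd z) \<in> K} (p, t) \<partial>lborel)
       = ennreal (t ^ ?n * exp (- t)) * indicator {0..} t * (ennreal (r ^ ?n) * emeasure lborel K)"
    proof (cases "0 < t")
      case True
      have "(\<integral>\<^sup>+ p. ennreal (exp (- t)) * indicator {z. 0 < snd z \<and> fst z /\<^sub>R (r * snd z) \<in> K} (p, t) \<partial>lborel)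
         = (\<integral>\<^sup>+ p. ennreal (exp (- t)) * indicator {p. p /\<^sub>R (r * t) \<in> K} p \<partial>lborel)"
        using True by (intro nn_integral_cong) (auto split: split_indicator)
      also have "\<dots> = ennreal (exp (- t)) * emeasure lborel {p. p /\<^sub>R (r * t) \<in> K}"
        by (rule nn_integral_cmult_indicator) measurable
      also have "\<dots> = ennreal (exp (- t)) * (ennreal ((r * t) ^ ?n) * emeasure lborel K)"
        using True r emeasure_lborel_dilation[OF K, of "r * t"] by simp
      finally show ?thesis
        using True r by (simp add: power_mult_distrib ennreal_mult mult_ac)
    next
      case False
      with \<open>t \<noteq> 0\<close> show ?thesis by simp
    qed
  qed
  also have "\<dots> = (\<integral>\<^sup>+ t. ennreal (t ^ ?n * exp (- t)) * indicator {0..} t \<partial>lborel) * (ennreal (r ^ ?n) * emeasure lborel K)"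
    by (rule nn_integral_multc) measurable
  also have "\<dots> = ennreal (fact ?n * r ^ ?n) * emeasure lborel K"
    using r by (simp add: nn_intergal_power_times_exp_Ici ennreal_mult mult.assoc)
  finally show ?thesis .
qed

lemma integral_lifted_cone:
  fixes K :: "(real^'n) set" and r :: real
  defines "C \<equiv> {x. 0 < snd (unlift x) \<and> fst (unlift x) /\<^sub>R (r * snd (unlift x)) \<in> K}"
  assumes K [measurable]: "K \<in> sets borel" and fin: "emeasure lborel K < \<infinity>" and r: "0 < r"
  shows "C \<in> sets borel"
    and "(\<lambda>x. exp (- (x \<bullet> lift (0, 1)))) absolutely_integrable_on C"
    and "integral C (\<lambda>x. exp (- (x \<bullet> lift (0, 1)))) = fact CARD('n) * r ^ CARD('n) * measure lebesgue K"
proof -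
  show C [measurable]: "C \<in> sets borel" unfolding C_def by measurable
  have height: "x \<bullet> lift (0, 1) = snd (unlift x)" for x :: "real^('n lifted)"
    using lift_inner[of "unlift x" "(0, 1)"] by simp
  let ?E = "\<lambda>x. indicator C x *\<^sub>R exp (- (x \<bullet> lift (0, 1)))"
  have "(\<integral>\<^sup>+ x. ennreal (?E x) \<partial>lborel) = (\<integral>\<^sup>+ z. ennreal (?E (lift z)) \<partial>(lborel :: ((real^'n) \<times> real) measure))"
    by (subst distr_lborel_lift[symmetric], subst nn_integral_distr) auto
  also have "\<dots> = (\<integral>\<^sup>+ z. ennreal (exp (- snd z)) * indicator {z. 0 < snd z \<and> fst z /\<^sub>R (r * snd z) \<in> K} z \<partial>lborel)"
    by (intro nn_integral_cong) (auto simp: C_def height split: split_indicator)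
  also have "\<dots> = ennreal (fact CARD('n) * r ^ CARD('n)) * emeasure lborel K"
    using nn_integral_cone[OF K r] by simp
  also have "emeasure lborel K = ennreal (measure lebesgue K)"
    using fin by (simp add: emeasure_eq_ennreal_measure measure_completion)
  also have "ennreal (fact CARD('n) * r ^ CARD('n)) * \<dots> = ennreal (fact CARD('n) * r ^ CARD('n) * measure lebesgue K)"
    using r by (intro ennreal_mult[symmetric]) auto
  finally have nn: "(\<integral>\<^sup>+ x. ennreal (?E x) \<partial>lborel) = ennreal (fact CARD('n) * r ^ CARD('n) * measure lebesgue K)" .
  have "has_bochner_integral lborel ?E (fact CARD('n) * r ^ CARD('n) * measure lebesgue K)"
    using r by (intro has_bochner_integral_nn_integral nn) auto
  then have *: "set_integrable lborel C (\<lambda>x. exp (- (x \<bullet> lift (0, 1))))"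
    "(LINT x:C|lborel. exp (- (x \<bullet> lift (0, 1)))) = fact CARD('n) * r ^ CARD('n) * measure lebesgue K"
    by (simp_all add: set_integrable_def set_lebesgue_integral_def has_bochner_integral_iff)
  then show "(\<lambda>x. exp (- (x \<bullet> lift (0, 1)))) absolutely_integrable_on C"
    by (simp add: set_integrable_def integrable_completion)
  show "integral C (\<lambda>x. exp (- (x \<bullet> lift (0, 1)))) = fact CARD('n) * r ^ CARD('n) * measure lebesgue K"
    using set_borel_integral_eq_integral(2)[OF *(1)] *(2) by simp
qed

section \<open>Wulff shapes of isotropic measures\<close>

text \<open>
  By second countability, the complement of the support is a union of countably many null sets.
\<close>

lemma AE_in_msupport:
  fixes \<nu> :: "'a::second_countable_topology measure"
  assumes open_sets: "\<And>U. open U \<Longrightarrow> U \<inter> space \<nu> \<in> sets \<nu>"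
  shows "AE u in \<nu>. u \<in> msupport \<nu>"
proof -
  obtain \<B> :: "'a set set" where \<B>: "countable \<B>" "topological_basis \<B>"
    using ex_countable_basis by blast
  define \<Z> where "\<Z> = {U \<in> \<B>. emeasure \<nu> (U \<inter> space \<nu>) = 0}"
  have "countable \<Z>" using \<B>(1) by (simp add: \<Z>_def)
  moreover have "U \<inter> space \<nu> \<in> null_sets \<nu>" if "U \<in> \<Z>" for U
    using that open_sets topological_basis_open[OF \<B>(2)] by (auto simp: \<Z>_def null_sets_def)
  ultimately have "(\<Union>U\<in>\<Z>. U \<inter> space \<nu>) \<in> null_sets \<nu>"
    by (rule null_sets_UN')
  then show ?thesis
  proof (rule AE_I')
    show "{u \<in> space \<nu>. u \<notin> msupport \<nu>} \<subseteq> (\<Union>U\<in>\<Z>. U \<inter> space \<nu>)"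
    proof safe
      fix u assume u: "u \<in> space \<nu>" "u \<notin> msupport \<nu>"
      then obtain U where U: "open U" "u \<in> U" "emeasure \<nu> (U \<inter> space \<nu>) = 0"
        by (auto simp: msupport_def)
      then obtain V where V: "V \<in> \<B>" "u \<in> V" "V \<subseteq> U"
        using topological_basisE[OF \<B>(2)] by metis
      have "emeasure \<nu> (V \<inter> space \<nu>) \<le> emeasure \<nu> (U \<inter> space \<nu>)"
        using V U open_sets by (intro emeasure_mono) auto
      then show "u \<in> (\<Union>U\<in>\<Z>. U \<inter> space \<nu>)" using U V u by (auto simp: \<Z>_def)
    qed
  qed
qed

lemma unit_vector_extreme_point:
  assumes "S \<subseteq> sphere 0 1" "u \<in> S"
  shows "u extreme_point_of (convex hull S :: 'a::euclidean_space set)"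
proof -
  have ball: "convex hull S \<subseteq> cball 0 1" using assms(1) by (intro hull_minimal) auto
  have "u \<notin> open_segment a b" if "a \<in> convex hull S" "b \<in> convex hull S" for a b
  proof
    assume "u \<in> open_segment a b"
    from dist_decreases_open_segment[OF this, of 0] that ball assms show False by force
  qed
  then show ?thesis using assms(2) hull_subset[of S convex] by (auto simp: extreme_point_of_def)
qed

text \<open>
  The data of the theorem. Inside the locale, \<open>r\<close> is the \<open>L\<^sup>2\<close> norm of \<open>f\<close>, \<open>w\<close> lifts a direction to \<open>\<real>\<^sup>n\<^sup>+\<^sup>1\<close>, and \<open>\<omega>\<close>
  with \<open>\<kappa>\<close> is the isotropic frame made of the normalised lifts.
\<close>

locale wulff_data =
  fixes f :: "real^'n \<Rightarrow> real" and \<nu> :: "(real^'n) measure"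
  assumes f_cont: "continuous_on (sphere 0 1) f"
    and f_pos: "u \<in> sphere 0 1 \<Longrightarrow> f u > 0"
    and nu_sphere: "sphere_measure \<nu>"
    and nu_isotropic: "isotropic \<nu>"
    and nu_centered: "f_centered f \<nu>"
begin

sublocale finite_measure \<nu>
  using nu_sphere by (simp add: sphere_measure_def)

lemma sets_nu: "sets \<nu> = sets (restrict_space borel (sphere 0 1))"
  using nu_sphere by (simp add: sphere_measure_def)

lemma space_nu: "space \<nu> = sphere 0 1"
  using sets_eq_imp_space_eq[OF sets_nu] by (simp add: space_restrict_space)

lemma norm_space: "u \<in> space \<nu> \<Longrightarrow> norm u = 1"
  by (simp add: space_nu)

lemma continuous_measurable:
  "continuous_on (sphere 0 1) g \<Longrightarrow> g \<in> borel_measurable \<nu>"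
  for g :: "real^'n \<Rightarrow> 'c::topological_space"
  using borel_measurable_continuous_on_restrict[of "sphere 0 1" g] measurable_cong_sets[OF sets_nu refl]
  by blast

lemma continuous_integrable:
  fixes g :: "real^'n \<Rightarrow> 'c::{banach, second_countable_topology}"
  assumes "continuous_on (sphere 0 1) g"
  shows "integrable \<nu> g"
proof -
  have "compact (g ` sphere 0 1)" by (intro compact_continuous_image assms compact_sphere)
  then obtain K where "\<forall>x\<in>g ` sphere 0 1. norm x \<le> K" using compact_imp_bounded bounded_iff by metis
  then show ?thesis
    using continuous_measurable[OF assms] by (intro integrable_const_bound[of g K]) (auto simp: space_nu)
qed

lemma isotropy_nu: "(\<integral>u. (u \<bullet> x) * (u \<bullet> y) \<partial>\<nu>) = x \<bullet> y"
proof -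
  define L where "L M = (M *v x) \<bullet> y" for M :: "real^'n^'n"
  have "linear L"
    unfolding L_def by (rule linearI)
      (simp_all add: matrix_vector_mult_add_rdistrib scaleR_matrix_vector_assoc[symmetric] inner_add_left)
  then have L: "bounded_linear L" by (simp add: linear_conv_bounded_linear)
  have "continuous_on (sphere 0 1) (\<lambda>u :: real^'n. u \<otimes>\<^sub>t u)"
    unfolding tensor_def by (intro continuous_on_vec_lambda continuous_intros)
  then have "(\<integral>u. L (u \<otimes>\<^sub>t u) \<partial>\<nu>) = L (\<integral>u. u \<otimes>\<^sub>t u \<partial>\<nu>)"
    by (intro integral_bounded_linear[OF L] continuous_integrable)
  also have "\<dots> = x \<bullet> y" using nu_isotropic by (simp add: isotropic_def L_def)
  finally show ?thesis by (simp add: L_def tensor_mult_vec inner_commute mult.commute)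
qed

lemma centered_nu: "(\<integral>u. f u * (u \<bullet> x) \<partial>\<nu>) = 0"
proof -
  have "integrable \<nu> (\<lambda>u. f u *\<^sub>R u)"
    by (intro continuous_integrable continuous_intros f_cont)
  from integral_inner_left[OF this, of x] show ?thesis
    using nu_centered by (simp add: f_centered_def)
qed

definition r :: real where "r = L2_norm \<nu> f"

lemma total_mass_nu: "(\<integral>u. 1 \<partial>\<nu>) = real CARD('n)"
proof -
  have "(\<integral>u. 1 \<partial>\<nu>) = (\<integral>u. (\<Sum>b\<in>Basis. (u \<bullet> b) * (u \<bullet> b)) \<partial>\<nu>)"
    by (intro Bochner_Integration.integral_cong refl)
       (simp add: euclidean_inner[symmetric] norm_eq_1[symmetric] norm_space)
  also have "\<dots> = (\<Sum>b\<in>Basis. (\<integral>u. (u \<bullet> b) * (u \<bullet> b) \<partial>\<nu>))"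
    by (intro Bochner_Integration.integral_sum continuous_integrable continuous_intros)
  finally show ?thesis by (simp add: isotropy_nu)
qed

lemma f_bounds: obtains m where "0 < m" "\<And>u. u \<in> sphere 0 1 \<Longrightarrow> m \<le> f u"
proof -
  have "sphere (0 :: real^'n) 1 \<noteq> {}" by simp
  then obtain u0 where "u0 \<in> sphere 0 1" "\<forall>u\<in>sphere 0 1. f u0 \<le> f u"
    using continuous_attains_inf[OF compact_sphere _ f_cont] by blast
  then show thesis using f_pos by (intro that[of "f u0"]) auto
qed

lemma r_sq: "(\<integral>u. (f u)\<^sup>2 \<partial>\<nu>) = r\<^sup>2"
  and r_pos: "0 < r"
proof -
  obtain m where m: "0 < m" "\<And>u. u \<in> sphere 0 1 \<Longrightarrow> m \<le> f u" using f_bounds by blast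
  have "0 < m\<^sup>2 * real CARD('n)" using m by simp
  also have "\<dots> = (\<integral>u. m\<^sup>2 * 1 \<partial>\<nu>)"
    by (subst integral_mult_right_zero) (simp only: total_mass_nu)
  also have "\<dots> \<le> (\<integral>u. (f u)\<^sup>2 \<partial>\<nu>)"
    using m by (intro integral_mono continuous_integrable continuous_intros f_cont)
      (auto simp: space_nu intro: power_mono)
  finally have "0 < (\<integral>u. (f u)\<^sup>2 \<partial>\<nu>)" .
  then show "(\<integral>u. (f u)\<^sup>2 \<partial>\<nu>) = r\<^sup>2" "0 < r"
    by (simp_all add: r_def L2_norm_def)
qed

abbreviation W where "W \<equiv> wulff_shape \<nu> f"

lemma msupport_subset: "msupport \<nu> \<subseteq> sphere 0 1"
  by (auto simp: msupport_def space_nu)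

lemma AE_msupport: "AE u in \<nu>. u \<in> msupport \<nu>"
proof (rule AE_in_msupport)
  show "U \<inter> space \<nu> \<in> sets \<nu>" if "open U" for U
    unfolding sets_nu space_nu using that
    by (auto simp: sets_restrict_space)
qed

lemma polar_wulff_closed: "closed (polar_body W)"
proof -
  have "polar_body W = (\<Inter>y\<in>W. {x. y \<bullet> x \<le> 1})"
    by (auto simp: polar_body_def inner_commute)
  then show ?thesis by (auto intro!: closed_INT closed_halfspace_le)
qed

text \<open>
  The Wulff shape contains the ball whose radius is the minimum \<open>m\<close> of \<open>f\<close>, so its polar lies in the ball of radius \<open>1 / m\<close>.
\<close>

lemma polar_wulff_emeasure: "emeasure lborel (polar_body W) < \<infinity>"
proof -
  obtain m where m: "0 < m" "\<And>u. u \<in> sphere 0 1 \<Longrightarrow> m \<le> f u" using f_bounds by blast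
  have "norm x \<le> 1 / m" if "x \<in> polar_body W" for x
  proof (cases "x = 0")
    case False
    have "(m / norm x) *\<^sub>R x \<in> W"
      unfolding wulff_shape_def
    proof safe
      fix u assume "u \<in> msupport \<nu>"
      then have u: "u \<in> sphere 0 1" using msupport_subset by blast
      have "x \<bullet> u \<le> norm x" using norm_cauchy_schwarz[of x u] u by simp
      then have "(m / norm x) *\<^sub>R x \<bullet> u \<le> m" using m(1) False by (simp add: field_simps)
      then show "(m / norm x) *\<^sub>R x \<bullet> u \<le> f u" using m(2)[OF u] by linarith
    qed
    then have "x \<bullet> ((m / norm x) *\<^sub>R x) \<le> 1" using that by (auto simp: polar_body_def)
    then have "norm x * m \<le> 1" using False by (simp add: power2_norm_eq_inner[symmetric] power2_eq_square mult.commute)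
    then show ?thesis using m(1) by (simp add: field_simps)
  qed (use m in auto)
  then have "bounded (polar_body W)" unfolding bounded_iff by blast
  then show ?thesis by (rule emeasure_bounded_finite)
qed

definition w :: "real^'n \<Rightarrow> real^('n lifted)" where "w u = lift (u, f u / r)"
definition \<omega> :: "real^'n \<Rightarrow> real^('n lifted)" where "\<omega> u = w u /\<^sub>R norm (w u)"
definition \<kappa> :: "(real^'n) measure" where "\<kappa> = density \<nu> (\<lambda>u. ennreal ((norm (w u))\<^sup>2))"
abbreviation e :: "real^('n lifted)" where "e \<equiv> lift (0, 1)"

lemma w_inner: "w u \<bullet> w v = u \<bullet> v + (f u / r) * (f v / r)"
  by (simp add: w_def lift_inner)

lemma w_inner_lift: "w u \<bullet> lift z = u \<bullet> fst z + (f u / r) * snd z"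
  by (simp add: w_def lift_inner)

lemma norm_w_sq: "u \<in> sphere 0 1 \<Longrightarrow> (norm (w u))\<^sup>2 = 1 + (f u / r)\<^sup>2"
  by (simp add: power2_norm_eq_inner w_inner norm_eq_1) (simp add: power2_eq_square)

lemma norm_w_pos: "u \<in> sphere 0 1 \<Longrightarrow> 0 < norm (w u)"
proof -
  assume "u \<in> sphere 0 1"
  from norm_w_sq[OF this] have "0 < (norm (w u))\<^sup>2" by (simp add: add_pos_nonneg)
  then show "0 < norm (w u)" by simp
qed

lemma w_cont: "continuous_on (sphere 0 1) w"
  unfolding w_def using r_pos
  by (intro continuous_on_compose2[OF continuous_on_lift] continuous_intros f_cont) auto

lemma omega_cont: "continuous_on (sphere 0 1) \<omega>"
  unfolding \<omega>_def using norm_w_pos by (intro continuous_intros w_cont) auto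

lemma space_kappa: "space \<kappa> = sphere 0 1"
  by (simp add: \<kappa>_def space_nu)

lemma w_measurable [measurable]: "w \<in> borel_measurable \<nu>"
  by (rule continuous_measurable[OF w_cont])

lemma AE_kappa: "(AE u in \<kappa>. P u) \<longleftrightarrow> (AE u in \<nu>. P u)"
proof -
  have "(AE u in \<kappa>. P u) \<longleftrightarrow> (AE u in \<nu>. 0 < ennreal ((norm (w u))\<^sup>2) \<longrightarrow> P u)"
    unfolding \<kappa>_def by (rule AE_density) measurable
  also have "\<dots> \<longleftrightarrow> (AE u in \<nu>. P u)"
    using norm_w_pos by (intro AE_cong) (simp add: space_nu)
  finally show ?thesis .
qed

lemma continuous_measurable_kappa:
  "continuous_on (sphere 0 1) g \<Longrightarrow> g \<in> borel_measurable \<kappa>"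
  for g :: "real^'n \<Rightarrow> 'c::topological_space"
  using continuous_measurable[of g] by (simp add: \<kappa>_def)

text \<open>
  The mixed terms vanish because \<open>\<nu>\<close> is \<open>f\<close>-centered, and the choice of \<open>r\<close> normalises the vertical direction.
\<close>

lemma isotropy_w: "(\<integral>u. (w u \<bullet> x) * (w u \<bullet> y) \<partial>\<nu>) = x \<bullet> y"
proof -
  obtain a s b t where x: "x = lift (a, s)" and y: "y = lift (b, t)"
    by (metis lift_unlift surj_pair)
  have "(w u \<bullet> x) * (w u \<bullet> y) = (u \<bullet> a) * (u \<bullet> b) + (t / r) * (f u * (u \<bullet> a)) + (s / r) * (f u * (u \<bullet> b)) + (s * t / r\<^sup>2) * (f u)\<^sup>2" for u
    by (simp add: x y w_inner_lift algebra_simps power2_eq_square)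
  then have "(\<integral>u. (w u \<bullet> x) * (w u \<bullet> y) \<partial>\<nu>) =
     (\<integral>u. (u \<bullet> a) * (u \<bullet> b) \<partial>\<nu>) + (t / r) * (\<integral>u. f u * (u \<bullet> a) \<partial>\<nu>) + (s / r) * (\<integral>u. f u * (u \<bullet> b) \<partial>\<nu>)
     + (s * t / r\<^sup>2) * (\<integral>u. (f u)\<^sup>2 \<partial>\<nu>)"
    by (simp add: continuous_integrable continuous_intros f_cont)
  also have "\<dots> = x \<bullet> y"
    using r_pos by (simp add: isotropy_nu centered_nu r_sq x y lift_inner)
  finally show ?thesis .
qed

lemma norm_omega: "u \<in> sphere 0 1 \<Longrightarrow> norm (\<omega> u) = 1"
  using norm_w_pos[of u] by (simp add: \<omega>_def)

sublocale frame: isotropic_frame \<kappa> \<omega>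
proof (intro isotropic_frame.intro isotropic_frame_axioms.intro finite_measureI)
  have int: "integrable \<nu> (\<lambda>u. (norm (w u))\<^sup>2)"
    by (intro continuous_integrable continuous_intros w_cont)
  then have "emeasure \<kappa> (space \<kappa>) = ennreal (\<integral>u. (norm (w u))\<^sup>2 \<partial>\<nu>)"
    unfolding \<kappa>_def by (simp add: emeasure_density nn_integral_eq_integral[symmetric] cong: nn_integral_cong)
  then show "emeasure \<kappa> (space \<kappa>) \<noteq> \<infinity>" by simp
  show "\<omega> \<in> borel_measurable \<kappa>" by (rule continuous_measurable_kappa[OF omega_cont])
  show "norm (\<omega> u) = 1" if "u \<in> space \<kappa>" for u using norm_omega that by (simp add: space_kappa)
  fix x y
  have m: "(\<lambda>u. (\<omega> u \<bullet> x) * (\<omega> u \<bullet> y)) \<in> borel_measurable \<nu>"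
    by (intro continuous_measurable continuous_intros omega_cont)
  have "(\<integral>u. (\<omega> u \<bullet> x) * (\<omega> u \<bullet> y) \<partial>\<kappa>) = (\<integral>u. (norm (w u))\<^sup>2 *\<^sub>R ((\<omega> u \<bullet> x) * (\<omega> u \<bullet> y)) \<partial>\<nu>)"
    unfolding \<kappa>_def by (rule integral_density) (use m in auto)
  also have "\<dots> = (\<integral>u. (w u \<bullet> x) * (w u \<bullet> y) \<partial>\<nu>)"
  proof (intro Bochner_Integration.integral_cong refl)
    fix u assume "u \<in> space \<nu>"
    then have "norm (w u) \<noteq> 0" using norm_w_pos[of u] by (simp add: space_nu)
    then show "(norm (w u))\<^sup>2 *\<^sub>R ((\<omega> u \<bullet> x) * (\<omega> u \<bullet> y)) = (w u \<bullet> x) * (w u \<bullet> y)"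
      by (simp add: \<omega>_def power2_eq_square field_simps)
  qed
  also have "\<dots> = x \<bullet> y" by (rule isotropy_w)
  finally show "(\<integral>u. (\<omega> u \<bullet> x) * (\<omega> u \<bullet> y) \<partial>\<kappa>) = x \<bullet> y" .
qed

lemma omega_inner_e: "\<omega> u \<bullet> e = (f u / r) / norm (w u)"
  by (simp add: \<omega>_def w_inner_lift divide_inverse mult.commute)

lemma omega_inner_e_bound: obtains \<delta> where "0 < \<delta>" "\<And>u. u \<in> sphere 0 1 \<Longrightarrow> \<delta> \<le> \<omega> u \<bullet> e"
proof -
  have pos: "0 < \<omega> u \<bullet> e" if "u \<in> sphere 0 1" for u
    using f_pos[OF that] r_pos norm_w_pos[OF that] by (simp add: omega_inner_e)
  have "continuous_on (sphere 0 1) (\<lambda>u. \<omega> u \<bullet> e)" by (intro continuous_intros omega_cont)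
  moreover have "sphere (0 :: real^'n) 1 \<noteq> {}" by simp
  ultimately obtain u0 where "u0 \<in> sphere 0 1" "\<forall>u\<in>sphere 0 1. \<omega> u0 \<bullet> e \<le> \<omega> u \<bullet> e"
    using continuous_attains_inf[OF compact_sphere] by blast
  then show thesis using pos by (intro that[of "\<omega> u0 \<bullet> e"]) auto
qed

lemma omega_in_msupport: "u \<in> msupport \<nu> \<Longrightarrow> \<omega> u \<in> msupport (distr \<kappa> borel \<omega>)"
  unfolding msupport_def[of "distr \<kappa> borel \<omega>"]
proof (intro CollectI conjI allI impI, simp)
  fix U assume u: "u \<in> msupport \<nu>" and U: "open U \<and> \<omega> u \<in> U"
  have us: "u \<in> sphere 0 1" using u msupport_subset by blast
  obtain V where V: "open V" "V \<inter> sphere 0 1 = \<omega> -` U \<inter> sphere 0 1"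
    using continuous_on_open_invariant[THEN iffD1, OF omega_cont] U by metis
  have "u \<in> V" using V(2) U us by blast
  then have "0 < emeasure \<nu> (V \<inter> space \<nu>)" using u V(1) by (auto simp: msupport_def)
  moreover have Vs: "V \<inter> space \<nu> \<in> sets \<nu>"
    unfolding sets_nu space_nu using V(1) by (auto simp: sets_restrict_space)
  ultimately have "\<not> (AE x in \<nu>. x \<notin> V \<inter> space \<nu>)"
    by (subst AE_iff_null_sets[symmetric]) auto
  then have "\<not> (AE x in \<kappa>. x \<notin> V \<inter> space \<nu>)" by (simp add: AE_kappa)
  moreover have "V \<inter> space \<nu> \<in> sets \<kappa>" using Vs by (simp add: \<kappa>_def)
  ultimately have "0 < emeasure \<kappa> (V \<inter> space \<nu>)"
    by (subst (asm) AE_iff_null_sets[symmetric]) (auto simp: null_sets_def zero_less_iff_neq_zero)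
  moreover have "\<omega> -` U \<inter> space \<kappa> = V \<inter> space \<nu>" using V(2) by (simp add: space_kappa space_nu)
  ultimately show "0 < emeasure (distr \<kappa> borel \<omega>) (U \<inter> space (distr \<kappa> borel \<omega>))"
    using U by (simp add: emeasure_distr frame.omega_measurable)
qed

definition cone :: "(real^('n lifted)) set" where
  "cone = {x. 0 < snd (unlift x) \<and> fst (unlift x) /\<^sub>R (r * snd (unlift x)) \<in> polar_body W}"

lemmas cone_facts = integral_lifted_cone[OF borel_closed[OF polar_wulff_closed] polar_wulff_emeasure r_pos,
    folded cone_def]

lemma inner_e: "x \<bullet> e = snd (unlift x)"
  using lift_inner[of "unlift x" "(0, 1)"] by simp

lemma inner_lift_0: "x \<bullet> lift (z, 0) = fst (unlift x) \<bullet> z"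
  using lift_inner[of "unlift x" "(z, 0)"] by simp

text \<open>
  The defining inequalities of the polar body, cleared of denominators, are linear in \<open>x\<close>.
\<close>

lemma in_cone_iff: "x \<in> cone \<longleftrightarrow> 0 < x \<bullet> e \<and> (\<forall>z\<in>W. x \<bullet> lift (z, 0) \<le> r * (x \<bullet> e))"
proof (cases "0 < x \<bullet> e")
  case True
  then have "0 < r * snd (unlift x)" using r_pos by (simp add: inner_e)
  then have "(fst (unlift x) /\<^sub>R (r * snd (unlift x))) \<bullet> z \<le> 1 \<longleftrightarrow> fst (unlift x) \<bullet> z \<le> r * snd (unlift x)" for z
    by (simp add: divide_inverse[symmetric] inverse_eq_divide pos_divide_le_eq del: inverse_mult_distrib)
  then show ?thesis using True by (simp add: cone_def polar_body_def inner_e inner_lift_0)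
qed (simp add: cone_def inner_e)

lemma omega_inner_lift_le:
  assumes "z \<in> W" "u \<in> msupport \<nu>"
  shows "\<omega> u \<bullet> lift (z, 0) \<le> r * (\<omega> u \<bullet> e)"
proof -
  have "z \<bullet> u \<le> f u" using assms by (auto simp: wulff_shape_def)
  then have "w u \<bullet> lift (z, 0) \<le> r * (w u \<bullet> e)"
    using r_pos by (simp add: w_inner_lift inner_commute[of u z])
  from mult_left_mono[OF this, of "inverse (norm (w u))"] show ?thesis
    by (simp add: \<omega>_def mult.left_commute)
qed

text \<open>
  The cone is cut out by linear inequalities that hold for every \<open>\<omega>(u)\<close> with \<open>u\<close> in the support, hence also for their
  weighted means.
\<close>

lemma weighted_mean_in_cone:
  assumes int: "integrable \<kappa> (\<lambda>u. h u *\<^sub>R \<omega> u)" and h: "\<And>u. u \<in> space \<kappa> \<Longrightarrow> 0 \<le> h u"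
    and pos: "0 < (\<integral>u. h u *\<^sub>R \<omega> u \<partial>\<kappa>) \<bullet> e"
  shows "(\<integral>u. h u *\<^sub>R \<omega> u \<partial>\<kappa>) \<in> cone"
  unfolding in_cone_iff
proof (intro conjI ballI pos)
  fix z assume z: "z \<in> W"
  have i: "integrable \<kappa> (\<lambda>u. h u *\<^sub>R \<omega> u \<bullet> x)" for x using int by (rule integrable_inner_left)
  have "(\<integral>u. h u *\<^sub>R \<omega> u \<bullet> lift (z, 0) \<partial>\<kappa>) \<le> (\<integral>u. r * (h u *\<^sub>R \<omega> u \<bullet> e) \<partial>\<kappa>)"
  proof (rule integral_mono_AE)
    show "AE u in \<kappa>. h u *\<^sub>R \<omega> u \<bullet> lift (z, 0) \<le> r * (h u *\<^sub>R \<omega> u \<bullet> e)"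
      using AE_msupport[folded AE_kappa] AE_space
    proof eventually_elim
      case (elim u)
      show ?case using mult_left_mono[OF omega_inner_lift_le[OF z elim(1)] h[OF elim(2)]]
        by (simp add: mult_ac)
    qed
  qed (use i in auto)
  then show "(\<integral>u. h u *\<^sub>R \<omega> u \<partial>\<kappa>) \<bullet> lift (z, 0) \<le> r * ((\<integral>u. h u *\<^sub>R \<omega> u \<partial>\<kappa>) \<bullet> e)"
    by (simp only: integral_inner_left[OF int, symmetric] integral_mult_right_zero)
qed

lemma cone_integral_bound:
  shows "(real CARD('n) + 1) powr ((real CARD('n) + 1) / 2) \<le> fact CARD('n) * r ^ CARD('n) * measure lebesgue (polar_body W)" (is ?ineq)
    and "fact CARD('n) * r ^ CARD('n) * measure lebesgue (polar_body W) = (real CARD('n) + 1) powr ((real CARD('n) + 1) / 2) \<Longrightarrow> u \<in> msupport \<nu> \<Longrightarrow>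
      \<omega> u \<bullet> e = 1 / sqrt (real CARD('n) + 1)"
    and "fact CARD('n) * r ^ CARD('n) * measure lebesgue (polar_body W) = (real CARD('n) + 1) powr ((real CARD('n) + 1) / 2) \<Longrightarrow> u \<in> msupport \<nu> \<Longrightarrow>
      v \<in> msupport \<nu> \<Longrightarrow> \<omega> u \<noteq> \<omega> v \<Longrightarrow> \<omega> u \<bullet> \<omega> v = 0"
proof -
  obtain \<tau> \<tau>' s1 s2 where \<tau>: "\<And>s. (\<tau> has_real_derivative \<tau>' s) (at s)" "continuous_on UNIV \<tau>'"
    "\<And>s. 0 < \<tau> s" "\<And>s. 0 < \<tau>' s"
    "\<And>s. ln (\<tau>' s) - \<tau> s = - (s\<^sup>2 / 2) - ln (2 * pi) / 2"
    "\<tau>' s1 \<noteq> \<tau>' s2"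
    by (rule gaussian_to_exponential_transport) blast
  obtain \<delta> where \<delta>: "0 < \<delta>" "\<And>u. u \<in> sphere 0 1 \<Longrightarrow> \<delta> \<le> \<omega> u \<bullet> e"
    by (rule omega_inner_e_bound) blast
  interpret cone_transport \<kappa> \<omega> e \<delta> \<tau> \<tau>'
  proof
    show "norm e = 1" by (simp add: norm_eq_1 lift_inner)
  qed (use \<tau> \<delta> in \<open>auto simp: space_kappa\<close>)
  have range: "range transport \<subseteq> cone"
  proof safe
    fix y
    have "0 < transport y \<bullet> e"
    proof -
      have "emeasure \<kappa> (space \<kappa>) \<noteq> 0"
        using measure_eq_dim by (auto simp: measure_def)
      then have "0 < (\<integral>u. \<tau> (\<omega> u \<bullet> y) \<partial>\<kappa>)"
        using frame.integral_less_AE_space[of "\<lambda>_. 0" "\<lambda>u. \<tau> (\<omega> u \<bullet> y)"] integrable_tau \<tau>(3) by simp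
      then show ?thesis by (simp add: transport_inner_e)
    qed
    then show "transport y \<in> cone"
      unfolding transport_def using \<tau>(3) inner_e_pos
      by (intro weighted_mean_in_cone integrable_transport) (auto intro: less_imp_le)
  qed
  have C: "cone \<in> sets lebesgue" using cone_facts(1) by simp
  have card: "real CARD('n lifted) = real CARD('n) + 1" by (simp add: card_lifted)
  note bounds = cone_integral_ge(1)[OF C range cone_facts(2)]
    cone_integral_eq_imp_orthogonal[OF C range cone_facts(2) _ \<tau>(6)]
  note bounds' = bounds[unfolded card cone_facts(3)]
  show ?ineq using bounds'(1) .
  assume eq: "fact CARD('n) * r ^ CARD('n) * measure lebesgue (polar_body W) = (real CARD('n) + 1) powr ((real CARD('n) + 1) / 2)"
    and u: "u \<in> msupport \<nu>"
  show "\<omega> u \<bullet> e = 1 / sqrt (real CARD('n) + 1)" using bounds'(2)[OF eq omega_in_msupport[OF u]] .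
  assume v: "v \<in> msupport \<nu>" and ne: "\<omega> u \<noteq> \<omega> v"
  show "\<omega> u \<bullet> \<omega> v = 0" using bounds'(3)[OF eq omega_in_msupport[OF u] omega_in_msupport[OF v] ne] .
qed

text \<open>
  A vector orthogonal to all \<open>\<omega>(u)\<close> of the support has norm 0 by isotropy, so these vectors span the space.
\<close>

lemma omega_orthonormal_basis:
  assumes "\<And>u v. u \<in> msupport \<nu> \<Longrightarrow> v \<in> msupport \<nu> \<Longrightarrow> \<omega> u \<noteq> \<omega> v \<Longrightarrow> \<omega> u \<bullet> \<omega> v = 0"
  shows "orthonormal_basis (\<omega> ` msupport \<nu>)"
  unfolding orthonormal_basis_def
proof (intro conjI)
  show "pairwise orthogonal (\<omega> ` msupport \<nu>)"
    using assms by (auto simp: pairwise_def orthogonal_def)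
  show "\<forall>b\<in>\<omega> ` msupport \<nu>. norm b = 1"
    using norm_omega msupport_subset by blast
  show "span (\<omega> ` msupport \<nu>) = UNIV"
  proof (rule ccontr)
    assume "span (\<omega> ` msupport \<nu>) \<noteq> UNIV"
    then obtain x where x: "x \<noteq> 0" "\<And>y. y \<in> span (\<omega> ` msupport \<nu>) \<Longrightarrow> orthogonal x y"
      using orthogonal_to_subspace_exists_gen[of "\<omega> ` msupport \<nu>" UNIV] by auto
    have "AE u in \<kappa>. (\<omega> u \<bullet> x) * (\<omega> u \<bullet> x) = 0"
      using AE_msupport[folded AE_kappa]
    proof eventually_elim
      case (elim u)
      then have "orthogonal x (\<omega> u)" by (intro x(2) span_base) auto
      then show ?case by (simp add: orthogonal_def inner_commute)
    qed
    then have "(\<integral>u. (\<omega> u \<bullet> x) * (\<omega> u \<bullet> x) \<partial>\<kappa>) = 0" by (rule integral_eq_zero_AE)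
    then show False using frame.isotropy[of x x] x(1) by simp
  qed
qed

lemma omega_inj: "inj_on \<omega> (sphere 0 1)"
proof (rule inj_onI)
  fix u v assume uv: "u \<in> sphere 0 1" "v \<in> sphere 0 1" and eq: "\<omega> u = \<omega> v"
  have \<omega>: "\<omega> u \<bullet> lift (z, 0) = (u \<bullet> z) / norm (w u)" for u z
    by (simp add: \<omega>_def w_inner_lift divide_inverse mult.commute)
  have "u /\<^sub>R norm (w u) = v /\<^sub>R norm (w v)"
  proof (rule vector_eq_ldot[THEN iffD1], rule allI)
    show "z \<bullet> (u /\<^sub>R norm (w u)) = z \<bullet> (v /\<^sub>R norm (w v))" for z
      using \<omega>[of u z] \<omega>[of v z] eq by (simp add: inner_commute[of z] divide_inverse mult.commute)
  qed
  moreover from this have "norm (u /\<^sub>R norm (w u)) = norm (v /\<^sub>R norm (w v))" by simp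
  then have "norm (w u) = norm (w v)" using uv by simp
  ultimately show "u = v" using norm_w_pos[OF uv(1)] by simp
qed

text \<open>
  With \<open>q = f(u) / r\<close>, the height of \<open>\<omega>(u)\<close> is \<open>q / \<surd>(1 + q\<^sup>2)\<close>. Equating it with \<open>1 / \<surd>(n + 1)\<close> gives
  \<open>q = 1 / \<surd>n\<close> on the support, so \<open>f\<close> is constant there. Orthogonality of \<open>w(u)\<close> and \<open>w(v)\<close> then reads
  \<open>u \<bullet> v = - 1 / n\<close>, and the orthonormal basis has \<open>n + 1\<close> elements.
\<close>

lemma simplex_if_extremal:
  assumes eq: "fact CARD('n) * r ^ CARD('n) * measure lebesgue (polar_body W) = (real CARD('n) + 1) powr ((real CARD('n) + 1) / 2)"
  shows "regular_simplex (convex hull (msupport \<nu>)) \<and> inscribed_in_unit_sphere (convex hull (msupport \<nu>))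
    \<and> f constant_on msupport \<nu>"
proof (intro conjI)
  let ?S = "msupport \<nu>"
  define n where "n = real CARD('n)"
  have n: "0 < n" by (simp add: n_def)
  have onb: "orthonormal_basis (\<omega> ` ?S)"
    using cone_integral_bound(3)[OF eq] by (intro omega_orthonormal_basis) auto
  have inj: "inj_on \<omega> ?S" using inj_on_subset[OF omega_inj msupport_subset] .
  have fin: "finite ?S" using orthonormal_basis_finite[OF onb] finite_imageD[OF _ inj] by blast
  have card: "card ?S = CARD('n) + 1"
    using orthonormal_basis_card[OF onb] card_image[OF inj] by (simp add: card_lifted)
  have quot: "f u / r = 1 / sqrt n" if "u \<in> ?S" for u
  proof -
    have us: "u \<in> sphere 0 1" using that msupport_subset by blast
    define q where "q = f u / r"
    have q: "0 < q" using f_pos[OF us] r_pos by (simp add: q_def)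
    have "q / norm (w u) = 1 / sqrt (n + 1)"
      using cone_integral_bound(2)[OF eq that] by (simp add: omega_inner_e q_def n_def)
    then have "q\<^sup>2 / (norm (w u))\<^sup>2 = 1 / (n + 1)"
      using n by (metis power_divide power_one real_sqrt_pow2 add_pos_pos less_imp_le zero_less_one)
    then have "q\<^sup>2 / (1 + q\<^sup>2) = 1 / (n + 1)" using norm_w_sq[OF us] by (simp add: q_def)
    then have "q\<^sup>2 * (n + 1) = 1 + q\<^sup>2" using n by (simp add: field_simps add_nonneg_eq_0_iff)
    then have "q\<^sup>2 = (1 / sqrt n)\<^sup>2" using n by (simp add: field_simps)
    then show ?thesis using q n by (simp add: q_def[symmetric] power2_eq_iff_nonneg)
  qed
  show "f constant_on ?S"
    unfolding constant_on_def
  proof (intro exI[of _ "r / sqrt n"] ballI)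
    show "f u = r / sqrt n" if "u \<in> ?S" for u using quot[OF that] r_pos by (simp add: field_simps)
  qed
  have inner: "u \<bullet> v = - 1 / n" if "u \<in> ?S" "v \<in> ?S" "u \<noteq> v" for u v
  proof -
    have us: "u \<in> sphere 0 1" "v \<in> sphere 0 1" using that msupport_subset by auto
    have "\<omega> u \<noteq> \<omega> v" using inj that by (auto simp: inj_on_def)
    then have "\<omega> u \<bullet> \<omega> v = 0" by (rule cone_integral_bound(3)[OF eq that(1,2)])
    then have "w u \<bullet> w v = 0" using norm_w_pos[OF us(1)] norm_w_pos[OF us(2)] by (auto simp: \<omega>_def)
    then show ?thesis using n by (simp add: w_inner quot that power2_eq_square[symmetric] field_simps)
  qed
  have unit: "u \<bullet> u = 1" if "u \<in> ?S" for u using that msupport_subset by (auto simp: norm_eq_1)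
  have "\<not> affine_dependent ?S"
  proof
    assume "affine_dependent ?S"
    then obtain U v where U: "sum U ?S = 0" "v \<in> ?S" "U v \<noteq> 0" "(\<Sum>u\<in>?S. U u *\<^sub>R u) = 0"
      using affine_dependent_explicit_finite[OF fin] by blast
    have "0 = (\<Sum>u\<in>?S. U u *\<^sub>R u) \<bullet> v" using U by simp
    also have "\<dots> = (\<Sum>u\<in>?S. U u * (u \<bullet> v))" by (simp add: inner_sum_left)
    also have "\<dots> = (\<Sum>u\<in>?S. U u * (- 1 / n) + (if u = v then U v * (1 + 1 / n) else 0))"
      using U(2) by (intro sum.cong refl) (auto simp: inner unit algebra_simps)
    also have "\<dots> = sum U ?S * (- 1 / n) + U v * (1 + 1 / n)"
      using fin U(2) by (simp add: sum.distrib sum_subtractf sum_divide_distrib)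
    also have "\<dots> = U v * (1 + 1 / n)" using U(1) by simp
    finally have "1 + 1 / n = 0" using U(3) by simp
    moreover have "0 < 1 + 1 / n" using n by (simp add: add_pos_pos)
    ultimately show False by simp
  qed
  then have simplex: "int DIM(real^'n) simplex (convex hull ?S)"
    by (intro simplex_convex_hull) (simp add: card)
  have dist: "dist u v = sqrt (2 + 2 / n)" if "u \<in> ?S" "v \<in> ?S" "u \<noteq> v" for u v
  proof -
    have "(dist u v)\<^sup>2 = 2 + 2 / n"
      using that by (simp add: dist_norm power2_norm_eq_inner inner_diff_left inner_diff_right unit inner inner_commute[of v u])
    then show ?thesis by (metis real_sqrt_unique zero_le_dist)
  qed
  show "regular_simplex (convex hull ?S)"
    unfolding regular_simplex_def using simplex dist extreme_point_of_convex_hull by blast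
  show "inscribed_in_unit_sphere (convex hull ?S)"
    unfolding inscribed_in_unit_sphere_def using extreme_point_of_convex_hull msupport_subset by blast
qed

text \<open>
  All points of the support are extreme points of its hull, so any two distinct ones have the same inner product \<open>\<rho>\<close>. It is
  determined without computing the masses of the points: for \<open>u\<^sub>0\<close> in the support,
  \<open>(u \<bullet> u\<^sub>0 - \<rho>) (u \<bullet> u\<^sub>0 - 1)\<close> vanishes on the support, and its integral is \<open>1 + \<rho> n\<close>. Thus \<open>\<rho> = - 1 / n\<close>, the lifts are
  pairwise orthogonal, and the points \<open>- c n v\<close> of the Wulff shape show that the cone lies in the orthant spanned by them.
\<close>

lemma extremal_if_simplex:
  assumes simplex: "regular_simplex (convex hull (msupport \<nu>))"
    and f_const: "f constant_on msupport \<nu>"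
  shows "fact CARD('n) * r ^ CARD('n) * measure lebesgue (polar_body W) \<le> (real CARD('n) + 1) powr ((real CARD('n) + 1) / 2)"
proof -
  let ?S = "msupport \<nu>"
  define n where "n = real CARD('n)"
  have n: "0 < n" by (simp add: n_def)
  have ext: "u extreme_point_of (convex hull ?S)" if "u \<in> ?S" for u
    by (rule unit_vector_extreme_point[OF msupport_subset that])
  obtain d where d: "\<And>u v. u \<in> ?S \<Longrightarrow> v \<in> ?S \<Longrightarrow> u \<noteq> v \<Longrightarrow> dist u v = d"
    using simplex ext unfolding regular_simplex_def by metis
  obtain c where c: "\<And>u. u \<in> ?S \<Longrightarrow> f u = c" using f_const by (auto simp: constant_on_def)
  have unit: "u \<bullet> u = 1" if "u \<in> ?S" for u using that msupport_subset by (auto simp: norm_eq_1)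
  define \<rho> where "\<rho> = 1 - d\<^sup>2 / 2"
  have inner: "u \<bullet> v = \<rho>" if "u \<in> ?S" "v \<in> ?S" "u \<noteq> v" for u v
  proof -
    have "d\<^sup>2 = (u - v) \<bullet> (u - v)" using d[OF that] by (simp add: dist_norm power2_norm_eq_inner[symmetric])
    also have "\<dots> = 2 - 2 * (u \<bullet> v)"
      using that by (simp add: inner_diff_left inner_diff_right unit inner_commute[of v u])
    finally show ?thesis by (simp add: \<rho>_def field_simps)
  qed
  have AEc: "AE u in \<nu>. f u = c" using AE_msupport by eventually_elim (rule c)
  have "\<not> (AE u in \<nu>. False)"
  proof
    assume "AE u in \<nu>. False"
    then have "(\<integral>u. (1 :: real) \<partial>\<nu>) = 0" by (intro integral_eq_zero_AE) (auto elim: eventually_mono)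
    then show False using total_mass_nu by simp
  qed
  then obtain u0 where u0: "u0 \<in> ?S"
    using AE_msupport by (metis (mono_tags, lifting) eventually_mono)
  have cpos: "0 < c" using c[OF u0] f_pos[of u0] u0 msupport_subset by auto
  have rsq: "r\<^sup>2 = c\<^sup>2 * n"
  proof -
    have "r\<^sup>2 = (\<integral>u. c\<^sup>2 * 1 \<partial>\<nu>)"
      unfolding r_sq[symmetric] using AEc
      by (intro integral_cong_AE) (auto intro!: continuous_measurable continuous_intros f_cont elim: eventually_mono)
    also have "\<dots> = c\<^sup>2 * n"
      by (subst integral_mult_right_zero) (simp only: total_mass_nu n_def)
    finally show ?thesis .
  qed
  have r: "r = c * sqrt n"
    using rsq r_pos cpos n by (metis less_imp_le mult_nonneg_nonneg power2_eq_iff_nonneg power_mult_distrib real_sqrt_ge_zero real_sqrt_pow2)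
  have quot: "f u / r = 1 / sqrt n" if "u \<in> ?S" for u using c[OF that] r cpos n by simp
  have mean0: "(\<integral>u. u \<bullet> v \<partial>\<nu>) = 0" for v
  proof -
    have "c * (\<integral>u. u \<bullet> v \<partial>\<nu>) = (\<integral>u. c * (u \<bullet> v) \<partial>\<nu>)" by simp
    also have "\<dots> = (\<integral>u. f u * (u \<bullet> v) \<partial>\<nu>)"
      using AEc by (intro integral_cong_AE) (auto intro!: continuous_measurable continuous_intros f_cont elim: eventually_mono)
    finally show ?thesis using centered_nu[of v] cpos by simp
  qed
  have \<rho>: "\<rho> = - 1 / n"
  proof -
    have "AE u in \<nu>. (u \<bullet> u0 - \<rho>) * (u \<bullet> u0 - 1) = 0"
      using AE_msupport
    proof eventually_elim
      case (elim u)
      then show ?case using inner[OF elim u0] unit[OF u0] by (cases "u = u0") auto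
    qed
    then have "0 = (\<integral>u. (u \<bullet> u0 - \<rho>) * (u \<bullet> u0 - 1) \<partial>\<nu>)" by (simp add: integral_eq_zero_AE)
    also have "\<dots> = (\<integral>u. (u \<bullet> u0) * (u \<bullet> u0) - (1 + \<rho>) * (u \<bullet> u0) + \<rho> * 1 \<partial>\<nu>)"
      by (intro Bochner_Integration.integral_cong refl) (simp add: algebra_simps)
    also have "\<dots> = (\<integral>u. (u \<bullet> u0) * (u \<bullet> u0) \<partial>\<nu>) - (1 + \<rho>) * (\<integral>u. u \<bullet> u0 \<partial>\<nu>) + \<rho> * (\<integral>u. 1 \<partial>\<nu>)"
      by (subst Bochner_Integration.integral_add Bochner_Integration.integral_diff integral_mult_right_zero;
          (intro continuous_integrable continuous_intros)?)+ (rule refl)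
    also have "\<dots> = 1 + \<rho> * n" by (simp only: isotropy_nu mean0 total_mass_nu unit[OF u0] n_def)
    finally show ?thesis using n by (simp add: field_simps)
  qed
  have "w u \<bullet> w v = 0" if "u \<in> ?S" "v \<in> ?S" "u \<noteq> v" for u v
    using that n by (simp add: w_inner inner \<rho> quot)
  then have onb: "orthonormal_basis (\<omega> ` ?S)"
    by (intro omega_orthonormal_basis) (auto simp: \<omega>_def)
  have nw: "norm (w u) = sqrt (n + 1) / sqrt n" if "u \<in> ?S" for u
  proof -
    have "(norm (w u))\<^sup>2 = (n + 1) / n"
      using norm_w_sq[of u] that msupport_subset n by (auto simp: quot power_divide field_simps)
    then show ?thesis by (metis norm_ge_zero real_sqrt_unique real_sqrt_divide)
  qed
  have heights: "e \<bullet> b = 1 / sqrt (real CARD('n lifted))" if "b \<in> \<omega> ` ?S" for b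
    using that n by (auto simp: inner_commute[of e] omega_inner_e quot nw card_lifted n_def[symmetric] add.commute)
  have orthant: "0 \<le> x \<bullet> b" if x: "x \<in> cone" and b: "b \<in> \<omega> ` ?S" for x b
  proof -
    obtain v where v: "v \<in> ?S" "b = \<omega> v" using b by blast
    have "(- (c * n)) *\<^sub>R v \<in> W"
      unfolding wulff_shape_def
    proof safe
      fix u assume u: "u \<in> ?S"
      show "(- (c * n)) *\<^sub>R v \<bullet> u \<le> f u"
      proof (cases "u = v")
        case True
        have "- (c * n) \<le> c" using cpos n by (simp add: order.trans[of _ 0])
        then show ?thesis using True unit[OF u] c[OF u] by simp
      next
        case False
        then show ?thesis using inner[OF v(1) u] n by (simp add: \<rho> c[OF u])
      qed
    qed
    then have "x \<bullet> lift ((- (c * n)) *\<^sub>R v, 0) \<le> r * (x \<bullet> e)"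
      using x unfolding in_cone_iff by blast
    then have "0 \<le> c * sqrt n * (x \<bullet> e) + (c * n) * (fst (unlift x) \<bullet> v)"
      by (simp add: inner_lift_0 r)
    also have "\<dots> = (c * n) * (fst (unlift x) \<bullet> v + (x \<bullet> e) / sqrt n)"
      using n by (simp add: field_simps real_sqrt_mult_self flip: real_sqrt_mult)
    finally have "0 \<le> fst (unlift x) \<bullet> v + (x \<bullet> e) / sqrt n"
      using mult_pos_pos[OF cpos n] by (simp only: zero_le_mult_iff) linarith
    also have "\<dots> = x \<bullet> w v"
      using w_inner_lift[of v "unlift x"] quot[OF v(1)] by (simp add: inner_e inner_commute)
    finally show ?thesis by (simp add: v(2) \<omega>_def)
  qed
  have "integral cone (\<lambda>x. exp (- (x \<bullet> e))) \<le> real CARD('n lifted) powr (real CARD('n lifted) / 2)"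
    by (rule integral_orthant_le[OF onb heights cone_facts(1) orthant cone_facts(2)])
  then show ?thesis by (simp only: cone_facts(3) card_lifted of_nat_add of_nat_1)
qed

end

theorem theorem2:
  fixes f :: "real^'n \<Rightarrow> real" and \<nu> :: "(real^'n) measure"
  assumes "CARD('n) \<ge> 2"
    and "continuous_on (sphere 0 1) f"
    and "\<And>u. u \<in> sphere 0 1 \<Longrightarrow> f u > 0"
    and "sphere_measure \<nu>"
    and "isotropic \<nu>"
    and "f_centered f \<nu>"
  shows "measure lebesgue (polar_body (wulff_shape \<nu> f))
           \<ge> (real CARD('n) + 1) powr ((real CARD('n) + 1) / 2) / fact CARD('n)
               * L2_norm \<nu> f powi (- int CARD('n))
       \<and> (measure lebesgue (polar_body (wulff_shape \<nu> f))
           = (real CARD('n) + 1) powr ((real CARD('n) + 1) / 2) / fact CARD('n)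
               * L2_norm \<nu> f powi (- int CARD('n))
         \<longleftrightarrow> regular_simplex (convex hull (msupport \<nu>))
             \<and> inscribed_in_unit_sphere (convex hull (msupport \<nu>))
             \<and> f constant_on msupport \<nu>)"
proof -
  interpret wulff_data f \<nu> using assms(2-) by unfold_locales
  define V where "V = measure lebesgue (polar_body (wulff_shape \<nu> f))"
  define B where "B = (real CARD('n) + 1) powr ((real CARD('n) + 1) / 2)"
  have k: "0 < fact CARD('n) * r ^ CARD('n)" using r_pos by simp
  have bound: "B / fact CARD('n) * L2_norm \<nu> f powi (- int CARD('n)) = B / (fact CARD('n) * r ^ CARD('n))"
    by (simp add: r_def[symmetric] power_int_minus field_simps)
  have ge: "B \<le> fact CARD('n) * r ^ CARD('n) * V"
    using cone_integral_bound(1) by (simp add: B_def V_def)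
  have "B / (fact CARD('n) * r ^ CARD('n)) \<le> V"
    using ge k by (simp add: pos_divide_le_eq mult.commute)
  moreover have "V = B / (fact CARD('n) * r ^ CARD('n)) \<longleftrightarrow> fact CARD('n) * r ^ CARD('n) * V = B"
    using k by (metis less_irrefl nonzero_eq_divide_eq mult.commute)
  moreover have "fact CARD('n) * r ^ CARD('n) * V = B \<longleftrightarrow> regular_simplex (convex hull (msupport \<nu>))
             \<and> inscribed_in_unit_sphere (convex hull (msupport \<nu>)) \<and> f constant_on msupport \<nu>"
    using simplex_if_extremal extremal_if_simplex ge unfolding B_def V_def by (metis order.antisym)
  ultimately show ?thesis unfolding V_def[symmetric] B_def[symmetric] bound by blast
qed

end
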